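(* Consider the multicolored multiple-drawing randomly reinforced urn described in the context. Assume: (A1) there is a constant $C_2$ such that $\sup_n \mathbb{E}(A_{nk}^3)<C_2$ for all $k\in\{1,\dots,d\}$; (A2) for all $k\in\{1,\dots,d\}$, $m_{nk}:=\mathbb{E}(A_{nk})\to m_k$ as $n\to\infty$, where $m_1,\dots,m_d$ are finite real numbers with $m_1=\dots=m_t>m_{t+1}\ge m_{t+2}\ge\dots\ge m_d$ for some $t\in\{1,\dots,d\}$; in addition $m_{n1}=m_{n2}=\dots=m_{nt}$ for all $n=1,2,\dots$. Then $\sum_{k=1}^{t}Z_{nk}\to 1$ almost surely as $n\to\infty$. As a result, for all $k\in\{t+1,\dots,d\}$, $Z_{nk}$ converges almost surely to $Z_k$ with $\mathbb P(Z_k=0)=1$.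
   Context: Urn model. An urn contains balls of $d$ distinct colors. The initial composition is $\mathbf H_0=(H_{01},\dots,H_{0d})^\top$, where $H_{0k}$ is the number of balls of color $k$, and $S_0=\sum_{k=1}^d H_{0k}$. At each stage $n\ge1$, a random number $N_n$ of balls is drawn without replacement; $\mathbf X_n=(X_{n1},\dots,X_{nd})^\top$ records the number of balls of each color drawn at stage $n$. The urn is then updated with the random replacement matrix $\mathbf R_n=\mathrm{diag}(A_{n1},\dots,A_{nd})$, so that $A_{nk}X_{nk}$ balls of color $k$ are added for each $k$. After $n$ stages, $H_{nk}=H_{0k}+\sum_{i=1}^n A_{ik}X_{ik}$, $\mathbf H_n=(H_{n1},\dots,H_{nd})^\top$, $S_n=\sum_{k=1}^d H_{nk}$ and $Z_{nk}=H_{nk}/S_n$. Let $\mathcal F_0$ be the trivial $\sigma$-field, $\mathcal F_n=\sigma\{N_1,\mathbf X_1,\mathbf R_1,\dots,N_n,\mathbf X_n,\mathbf R_n\}$ and $\mathcal G_n=\sigma\{N_1,\mathbf X_1,\mathbf R_1,\dots,N_n,\mathbf X_n,\mathbf R_n,N_{n+1}\}$. Standing assumptions: (I) The support of $N_{n+1}$ is contained in $\{1\wedge C_1,2\wedge C_1,\dots,S_n\wedge C_1\}$, where $C_1$ is some constant. (II) Conditionally on $\mathcal G_n$, $\mathbf X_{n+1}$ is multivariate hypergeometric with parameters $(S_n,N_{n+1},\mathbf H_n)$: $\mathbb P(\mathbf X_{n+1}=\mathbf x\mid\mathcal G_n)=\prod_{k=1}^d\binom{H_{nk}}{x_k}\big/\binom{S_n}{N_{n+1}}$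 for $\mathbf x=(x_1,\dots,x_d)^\top$ with $0\le x_k\le H_{nk}$ and $\sum_{k=1}^d x_k=N_{n+1}$. (III) For all $k$, $A_{n+1,k}$ takes values in $[1,+\infty)$, and $\mathbf R_{n+1}$ is independent of $\mathcal G_n$. The components of $\mathbf R_{n+1}$ may be correlated with each other.
   Formalization: In (III), R_{n+1} is assumed independent of G_n together with the draw X_{n+1}, since independence of G_n alone lets the replacements be coupled with the draw and the claim then fails; ball counts H_{nk} are integers, and every color is initially present. *)

theory Defs
  imports "HOL-Probability.Probability"
begin

text \<open>
  Colours are indexed by \<open>{1..d}\<close> and stages by \<open>n \<ge> 1\<close>; index \<open>0\<close> of \<open>N\<close>, \<open>X\<close>, \<open>A\<close> is never used.
  The diagonal matrix \<open>R\<^sub>n = diag(A\<^sub>n\<^sub>1, \<dots>, A\<^sub>n\<^sub>d)\<close> is represented by its diagonal.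
\<close>

definition total :: "nat \<Rightarrow> (nat \<Rightarrow> nat \<Rightarrow> 'a \<Rightarrow> nat) \<Rightarrow> nat \<Rightarrow> 'a \<Rightarrow> nat" where
  "total d H n \<omega> = (\<Sum>k=1..d. H n k \<omega>)"

definition proportion :: "nat \<Rightarrow> (nat \<Rightarrow> nat \<Rightarrow> 'a \<Rightarrow> nat) \<Rightarrow> nat \<Rightarrow> nat \<Rightarrow> 'a \<Rightarrow> real" where
  "proportion d H n k \<omega> = real (H n k \<omega>) / real (total d H n \<omega>)"

definition vec_alg ::
  "'a measure \<Rightarrow> nat \<Rightarrow> 'b measure \<Rightarrow> (nat \<Rightarrow> 'a \<Rightarrow> 'b) \<Rightarrow> 'a measure" where
  "vec_alg M d E Y =
     vimage_algebra (space M) (\<lambda>\<omega>. \<lambda>k\<in>{1..d}. Y k \<omega>) (\<Pi>\<^sub>M k\<in>{1..d}. E)"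

definition urn_F ::
  "'a measure \<Rightarrow> nat \<Rightarrow> (nat \<Rightarrow> 'a \<Rightarrow> nat) \<Rightarrow> (nat \<Rightarrow> nat \<Rightarrow> 'a \<Rightarrow> nat) \<Rightarrow>
   (nat \<Rightarrow> nat \<Rightarrow> 'a \<Rightarrow> real) \<Rightarrow> nat \<Rightarrow> 'a measure" where
  "urn_F M d N X A n = sigma (space M)
     (\<Union>i\<in>{1..n}. sets (vimage_algebra (space M) (N i) (count_space UNIV))
        \<union> sets (vec_alg M d (count_space UNIV) (X i))
        \<union> sets (vec_alg M d borel (A i)))"

definition urn_G ::
  "'a measure \<Rightarrow> nat \<Rightarrow> (nat \<Rightarrow> 'a \<Rightarrow> nat) \<Rightarrow> (nat \<Rightarrow> nat \<Rightarrow> 'a \<Rightarrow> nat) \<Rightarrow>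
   (nat \<Rightarrow> nat \<Rightarrow> 'a \<Rightarrow> real) \<Rightarrow> nat \<Rightarrow> 'a measure" where
  "urn_G M d N X A n = sigma (space M)
     (sets (urn_F M d N X A n)
        \<union> sets (vimage_algebra (space M) (N (Suc n)) (count_space UNIV)))"

definition multi_hypergeom_prob ::
  "nat \<Rightarrow> nat \<Rightarrow> nat \<Rightarrow> (nat \<Rightarrow> nat) \<Rightarrow> (nat \<Rightarrow> nat) \<Rightarrow> real" where
  "multi_hypergeom_prob d s n h x =
     (if (\<forall>k\<in>{1..d}. x k \<le> h k) \<and> (\<Sum>k=1..d. x k) = n
      then (\<Prod>k=1..d. real (h k choose x k)) / real (s choose n)
      else 0)"

text \<open>
  The numbers \<open>A n k\<close> are real, but \<open>H n k\<close> counts balls: assumption \<open>composition\<close> both gives the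
  evolution of the urn and says that \<open>A n k * X n k\<close>, the number of balls added, is an integer.

  Assumption \<open>replacement_indep\<close> asks \<open>R\<^sub>n\<^sub>+\<^sub>1\<close> to be independent of the sigma-field generated by
  \<open>G\<^sub>n\<close> \<^emph>\<open>and the draw\<close> \<open>X\<^sub>n\<^sub>+\<^sub>1\<close>, i.e. independent of \<open>G\<^sub>n\<close> and, conditionally on \<open>G\<^sub>n\<close>, of
  \<open>X\<^sub>n\<^sub>+\<^sub>1\<close>. With independence of \<open>G\<^sub>n\<close> alone, the reinforcement could be coupled with the draw so that
  \<open>E[A\<^sub>n\<^sub>+\<^sub>1\<^sub>,\<^sub>k X\<^sub>n\<^sub>+\<^sub>1\<^sub>,\<^sub>k | G\<^sub>n]\<close> is not \<open>E[A\<^sub>n\<^sub>+\<^sub>1\<^sub>,\<^sub>k] E[X\<^sub>n\<^sub>+\<^sub>1\<^sub>,\<^sub>k | G\<^sub>n]\<close>, and the means of the \<open>A\<close>s would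
  not determine which colours dominate.
\<close>

locale multidraw_urn = prob_space M
  for M :: "'a measure" +
  fixes d :: nat
    and C1 :: real
    and H0 :: "nat \<Rightarrow> nat"
    and N :: "nat \<Rightarrow> 'a \<Rightarrow> nat"
    and X :: "nat \<Rightarrow> nat \<Rightarrow> 'a \<Rightarrow> nat"
    and A :: "nat \<Rightarrow> nat \<Rightarrow> 'a \<Rightarrow> real"
    and H :: "nat \<Rightarrow> nat \<Rightarrow> 'a \<Rightarrow> nat"
  assumes C1_pos: "C1 > 0"
    and initial_pos: "\<And>k. k \<in> {1..d} \<Longrightarrow> H0 k > 0"
    and N_measurable: "\<And>n. n \<ge> 1 \<Longrightarrow> N n \<in> measurable M (count_space UNIV)"
    and X_measurable:
      "\<And>n k. n \<ge> 1 \<Longrightarrow> k \<in> {1..d} \<Longrightarrow> X n k \<in> measurable M (count_space UNIV)"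
    and A_measurable:
      "\<And>n k. n \<ge> 1 \<Longrightarrow> k \<in> {1..d} \<Longrightarrow> A n k \<in> borel_measurable M"
    and composition:
      "\<And>n k \<omega>. k \<in> {1..d} \<Longrightarrow> \<omega> \<in> space M \<Longrightarrow>
         real (H n k \<omega>) = real (H0 k) + (\<Sum>i=1..n. A i k \<omega> * real (X i k \<omega>))"
    and sample_size:
      "\<And>n. AE \<omega> in M. real (N (Suc n) \<omega>) \<in> (\<lambda>j. min (real j) C1) ` {1..total d H n \<omega>}"
    and draw_hypergeometric:
      "\<And>n x. AE \<omega> in M.
         real_cond_exp M (urn_G M d N X A n)
           (indicator {\<omega>' \<in> space M. \<forall>k\<in>{1..d}. X (Suc n) k \<omega>' = x k}) \<omega>
         = multi_hypergeom_prob d (total d H n \<omega>) (N (Suc n) \<omega>) (\<lambda>k. H n k \<omega>) x"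
    and replacement_ge_1:
      "\<And>n k \<omega>. n \<ge> 1 \<Longrightarrow> k \<in> {1..d} \<Longrightarrow> \<omega> \<in> space M \<Longrightarrow> A n k \<omega> \<ge> 1"
    and replacement_indep:
      "\<And>n. indep_set (sets (vec_alg M d borel (A (Suc n))))
         (sets (sigma (space M)
            (sets (urn_G M d N X A n) \<union> sets (vec_alg M d (count_space UNIV) (X (Suc n))))))"

end

theory Submission
  imports Defs "HOL-Real_Asymp.Real_Asymp"
begin

text \<open>
  Let \<open>j\<close> be a colour with \<open>m\<^sub>j < m\<^sub>1\<close>. Put \<open>a\<^sub>k = X\<^sub>n\<^sub>+\<^sub>1\<^sub>,\<^sub>k / H\<^sub>n\<^sub>k\<close> and \<open>b = N\<^sub>n\<^sub>+\<^sub>1 / S\<^sub>n\<close>. The count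
  of colour \<open>k\<close> is multiplied by \<open>1 + A\<^sub>n\<^sub>+\<^sub>1\<^sub>,\<^sub>k a\<^sub>k\<close> at stage \<open>n + 1\<close>, and
  \<open>x - x\<^sup>2 \<le> ln (1 + x) \<le> x\<close> for \<open>x \<ge> 0\<close>; so \<open>ln (H\<^sub>n\<^sub>j / H\<^sub>n\<^sub>1)\<close> is at most a constant plus
  the sum of \<open>A\<^sub>n\<^sub>+\<^sub>1\<^sub>,\<^sub>j a\<^sub>j - A\<^sub>n\<^sub>+\<^sub>1\<^sub>,\<^sub>1 a\<^sub>1\<close> plus the sum of \<open>(A\<^sub>n\<^sub>+\<^sub>1\<^sub>,\<^sub>1 a\<^sub>1)\<^sup>2\<close>.

  The hypergeometric mean, obtained from a multivariate Vandermonde identity, and the independence of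
  the replacements from the draw give \<open>E[A\<^sub>n\<^sub>+\<^sub>1\<^sub>,\<^sub>k a\<^sub>k | G\<^sub>n] = E(A\<^sub>n\<^sub>+\<^sub>1\<^sub>,\<^sub>k) b\<close>. Hence, up to
  martingale differences, the first sum has the drift \<open>(E(A\<^sub>n\<^sub>+\<^sub>1\<^sub>,\<^sub>j) - E(A\<^sub>n\<^sub>+\<^sub>1\<^sub>,\<^sub>1)) b\<close>, which is
  eventually at most \<open>-\<epsilon> / S\<^sub>n\<close>. As \<open>E(S\<^sub>n)\<close> grows at most linearly, the sum of \<open>1 / S\<^sub>n\<close> diverges
  almost surely (\<open>AE_not_summable_inverse_total\<close>), and the drift tends to \<open>-\<infinity>\<close>.

  All the other terms stay bounded, whatever the growth rates of the single colours are: at each stage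
  \<open>1 / H\<^sub>n\<^sub>k\<close> decreases by at least a constant multiple of \<open>a\<^sub>k\<^sup>2\<close>, so the sum of \<open>a\<^sub>k\<^sup>2\<close> is bounded by a
  deterministic constant (\<open>AE_sum_draw_ratio_square\<close>). With bounded second moments of the
  replacements, the sums of \<open>E((A\<^sub>n\<^sub>+\<^sub>1\<^sub>,\<^sub>k a\<^sub>k)\<^sup>2)\<close> and of the variances of the martingale differences
  are finite, and a maximal inequality (\<open>AE_bounded_partial_sums\<close>) bounds the martingale. Therefore
  \<open>H\<^sub>n\<^sub>j / H\<^sub>n\<^sub>1\<close> and with it \<open>Z\<^sub>n\<^sub>j\<close> tend to zero (\<open>AE_dominated_proportion\<close>). The proportions add up to
  one, which leaves the limit one for the colours \<open>1, \<dots>, t\<close>.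
\<close>

section \<open>The mean of the multivariate hypergeometric distribution\<close>

text \<open>
  The tuples of naturals indexed by \<open>I\<close> whose entries add up to \<open>n\<close>, as extensional functions,
  so that each tuple is represented once. They are the possible outcomes of a draw of \<open>n\<close> balls.
\<close>

definition compositions :: "'a set \<Rightarrow> nat \<Rightarrow> ('a \<Rightarrow> nat) set" where
  "compositions I n = {x \<in> I \<rightarrow>\<^sub>E UNIV. sum x I = n}"

lemma compositions_empty [simp]:
  "compositions {} n = (if n = 0 then {\<lambda>_. undefined} else {})"
  by (auto simp: compositions_def)

lemma compositions_subset_PiE:
  assumes "finite I" "n \<le> c"
  shows "compositions I n \<subseteq> I \<rightarrow>\<^sub>E {..c}"
proof
  fix x assume "x \<in> compositions I n"
  then have x: "x \<in> I \<rightarrow>\<^sub>E UNIV" "sum x I = n" by (auto simp: compositions_def)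
  have "x i \<le> c" if "i \<in> I" for i
    using member_le_sum[of i I x] that assms x(2) by simp
  with x(1) show "x \<in> I \<rightarrow>\<^sub>E {..c}" by (auto simp: PiE_iff)
qed

lemma finite_compositions: "finite I \<Longrightarrow> finite (compositions I n)"
  by (rule finite_subset[OF compositions_subset_PiE[OF _ order_refl]])
     (auto intro: finite_PiE)

lemma sum_compositions_insert:
  fixes f :: "nat \<Rightarrow> 'b::comm_semiring_0"
  assumes "finite I" "a \<notin> I"
  shows "(\<Sum>x\<in>compositions (insert a I) n. f (x a) * g (restrict x I))
       = (\<Sum>j\<le>n. f j * (\<Sum>y\<in>compositions I (n - j). g y))"
proof -
  have "(\<Sum>j\<le>n. f j * (\<Sum>y\<in>compositions I (n - j). g y))
      = (\<Sum>(j, y)\<in>(SIGMA j:{..n}. compositions I (n - j)). f j * g y)"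
    by (subst sum.Sigma[symmetric]) (auto simp: assms finite_compositions sum_distrib_left)
  also have "\<dots> = (\<Sum>x\<in>compositions (insert a I) n. f (x a) * g (restrict x I))"
  proof (rule sum.reindex_bij_witness[where i = "\<lambda>x. (x a, restrict x I)"
        and j = "\<lambda>(j, y). y(a := j)"], goal_cases)
    case (1 p)
    then show ?case using assms(2)
      by (auto simp: compositions_def fun_eq_iff PiE_iff extensional_def)
  next
    case (2 p)
    then obtain j y where p: "p = (j, y)" "sum y I = n - j" "j \<le> n" "y \<in> I \<rightarrow>\<^sub>E UNIV"
      by (auto simp: compositions_def)
    moreover have "sum (y(a := j)) I = sum y I"
      by (rule sum.cong) (use assms in auto)
    ultimately show ?case using assms
      by (simp add: compositions_def PiE_iff extensional_def)
  next
    case (3 x)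
    then show ?case
      by (auto simp: compositions_def fun_eq_iff PiE_iff extensional_def)
  next
    case (4 x)
    then show ?case using assms
      by (auto simp: compositions_def PiE_iff)
  next
    case (5 p)
    have "restrict ((snd p)(a := fst p)) I = snd p" using 5 assms(2)
      by (auto simp: compositions_def fun_eq_iff PiE_iff extensional_def)
    then show ?case by (auto split: prod.splits)
  qed
  finally show ?thesis ..
qed

lemma multivariate_vandermonde:
  assumes "finite I"
  shows "(\<Sum>x\<in>compositions I n. \<Prod>i\<in>I. h i choose x i) = (sum h I choose n)"
  using assms
proof (induction I arbitrary: n)
  case empty
  then show ?case by auto
next
  case (insert a I)
  have "(\<Sum>x\<in>compositions (insert a I) n. \<Prod>i\<in>insert a I. h i choose x i)
      = (\<Sum>x\<in>compositions (insert a I) n.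
          (h a choose x a) * (\<Prod>i\<in>I. h i choose restrict x I i))"
    using insert.hyps by simp
  also have "\<dots> = (\<Sum>j\<le>n. (h a choose j) * (sum h I choose (n - j)))"
    using insert.hyps
    by (subst sum_compositions_insert[where f = "\<lambda>j. h a choose j"
          and g = "\<lambda>y. \<Prod>i\<in>I. h i choose y i"]) (simp_all add: insert.IH)
  also have "\<dots> = (sum h (insert a I) choose n)"
    using insert.hyps by (simp add: vandermonde)
  finally show ?case .
qed

lemma multivariate_vandermonde_mean:
  assumes "finite I" "k \<in> I" "n \<ge> 1"
  shows "(\<Sum>x\<in>compositions I n. x k * (\<Prod>i\<in>I. h i choose x i))
       = h k * ((sum h I - 1) choose (n - 1))"
proof -
  define J where "J = I - {k}"
  have J: "finite J" "k \<notin> J" "insert k J = I" using assms by (auto simp: J_def)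
  obtain n' where n': "n = Suc n'" using assms(3) by (cases n) auto
  have "(\<Sum>x\<in>compositions I n. x k * (\<Prod>i\<in>I. h i choose x i))
      = (\<Sum>x\<in>compositions (insert k J) n. (x k * (h k choose x k)) *
          (\<Prod>i\<in>J. h i choose restrict x J i))"
    unfolding J(3)[symmetric] using J(1,2) by (simp add: mult.assoc)
  also have "\<dots> = (\<Sum>j\<le>n. (j * (h k choose j)) * (sum h J choose (n - j)))"
    using J by (subst sum_compositions_insert[where f = "\<lambda>j. j * (h k choose j)"
          and g = "\<lambda>y. \<Prod>i\<in>J. h i choose y i"]) (simp_all add: multivariate_vandermonde)
  also have "\<dots> = (\<Sum>j\<le>n'. (Suc j * (h k choose Suc j)) * (sum h J choose (n' - j)))"
    by (simp only: n' sum.atMost_Suc_shift) simp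
  also have "\<dots> = h k * (\<Sum>j\<le>n'. ((h k - 1) choose j) * (sum h J choose (n' - j)))"
    unfolding sum_distrib_left
    by (intro sum.cong refl) (simp only: binomial_absorption mult.assoc)
  also have "\<dots> = h k * ((h k - 1 + sum h J) choose n')"
    by (simp add: vandermonde)
  also have "\<dots> = h k * ((sum h I - 1) choose (n - 1))"
    using J by (cases "h k") (auto simp: n' J(3)[symmetric])
  finally show ?thesis .
qed

text \<open>The condition \<open>x k \<le> h k\<close> is redundant, as the binomial coefficient vanishes otherwise.\<close>

lemma multi_hypergeom_prob_eq:
  "multi_hypergeom_prob d s n h x =
     (if (\<Sum>k=1..d. x k) = n then (\<Prod>k=1..d. real (h k choose x k)) / real (s choose n) else 0)"
proof -
  have "(\<Prod>k=1..d. real (h k choose x k)) = 0" if "\<not> (\<forall>k\<in>{1..d}. x k \<le> h k)"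
    using that by (auto simp: not_le intro!: binomial_eq_0)
  then show ?thesis by (auto simp: multi_hypergeom_prob_def)
qed

text \<open>
  Summing over the box with any upper corner \<open>c \<ge> n\<close> gives an index set that does not depend on the
  sample size \<open>n\<close>, which is random in the application.
\<close>

lemma multi_hypergeom_mean:
  assumes "k \<in> {1..d}" "1 \<le> n" "n \<le> s" "s = (\<Sum>i=1..d. h i)" "n \<le> c"
  shows "(\<Sum>x\<in>{1..d} \<rightarrow>\<^sub>E {..c}. real (x k) * multi_hypergeom_prob d s n h x)
       = real n * real (h k) / real s"
proof -
  obtain n' s' where ns: "n = Suc n'" "s = Suc s'"
    using assms(2,3) by (metis Suc_le_D le_trans One_nat_def)
  have "(\<Sum>x\<in>{1..d} \<rightarrow>\<^sub>E {..c}. real (x k) * multi_hypergeom_prob d s n h x)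
      = (\<Sum>x\<in>compositions {1..d} n. real (x k) * multi_hypergeom_prob d s n h x)"
  proof (rule sum.mono_neutral_right)
    show "\<forall>x\<in>({1..d} \<rightarrow>\<^sub>E {..c}) - compositions {1..d} n.
            real (x k) * multi_hypergeom_prob d s n h x = 0"
      by (auto simp: compositions_def multi_hypergeom_prob_eq PiE_iff)
  next
    show "compositions {1..d} n \<subseteq> {1..d} \<rightarrow>\<^sub>E {..c}"
      by (rule compositions_subset_PiE) (use assms in simp_all)
  qed (simp add: finite_PiE)
  also have "\<dots> = (\<Sum>x\<in>compositions {1..d} n. real (x k * (\<Prod>i\<in>{1..d}. h i choose x i)))
                    / real (s choose n)"
    unfolding sum_divide_distrib
    by (intro sum.cong) (auto simp: multi_hypergeom_prob_eq compositions_def)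
  also have "\<dots> = real (h k * ((s - 1) choose (n - 1))) / real (s choose n)"
    using assms by (simp only: of_nat_sum[symmetric] multivariate_vandermonde_mean
        finite_atLeastAtMost)
  also have "\<dots> = real n * real (h k) / real s"
  proof -
    have "Suc n' * (Suc s' choose Suc n') = Suc s' * (s' choose n')"
      using Suc_times_binomial_eq[of s' n'] by (simp add: ac_simps)
    then have "real (Suc n') * real (Suc s' choose Suc n') = real (Suc s') * real (s' choose n')"
      by (metis of_nat_mult)
    moreover have "real (Suc s' choose Suc n') > 0"
      using assms(3) ns by (simp only: of_nat_0_less_iff zero_less_binomial_iff)
    ultimately have "real (s' choose n') / real (Suc s' choose Suc n') = real (Suc n') / real (Suc s')"
      by (subst frac_eq_eq) (simp_all add: mult.commute)
    then have "real (h k) * (real (s' choose n') / real (Suc s' choose Suc n'))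
        = real (h k) * (real (Suc n') / real (Suc s'))"
      by (rule arg_cong)
    then show ?thesis
      by (simp only: ns diff_Suc_1 of_nat_mult times_divide_eq_right mult.commute)
  qed
  finally show ?thesis .
qed

section \<open>Almost sure boundedness and divergence of series\<close>

text \<open>
  Partial sums of square-summable martingale differences are almost surely bounded. This is
  Kolmogorov's maximal inequality; the martingale property is expressed by orthogonality of
  \<open>D n\<close> to the bounded \<open>G n\<close>-measurable functions. Bounded test functions suffice because the sums
  are stopped as soon as they leave \<open>{-L<..<L}\<close>.
\<close>

lemma (in prob_space) AE_bounded_partial_sums:
  fixes D :: "nat \<Rightarrow> 'a \<Rightarrow> real" and G :: "nat \<Rightarrow> 'a measure"
  assumes sub: "\<And>n. subalgebra M (G n)"
    and adapted: "\<And>i n. i < n \<Longrightarrow> D i \<in> borel_measurable (G n)"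
    and square_int: "\<And>n. integrable M (\<lambda>\<omega>. (D n \<omega>)\<^sup>2)"
    and orth: "\<And>n Y c. Y \<in> borel_measurable (G n) \<Longrightarrow>
          (\<And>\<omega>. \<omega> \<in> space M \<Longrightarrow> \<bar>Y \<omega>\<bar> \<le> c) \<Longrightarrow> (\<integral>\<omega>. D n \<omega> * Y \<omega> \<partial>M) = 0"
    and bound: "\<And>n. (\<Sum>i<n. \<integral>\<omega>. (D i \<omega>)\<^sup>2 \<partial>M) \<le> K"
  shows "AE \<omega> in M. \<exists>B. \<forall>n. \<bar>\<Sum>i<n. D i \<omega>\<bar> \<le> B"
proof -
  define P where "P = (\<lambda>n \<omega>. \<Sum>i<n. D i \<omega>)"
  have [measurable]: "D n \<in> borel_measurable M" for n
    using measurable_from_subalg[OF sub adapted[OF lessI]] .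
  have [measurable]: "P n \<in> borel_measurable M" for n
    unfolding P_def by measurable
  have PG: "P i \<in> borel_measurable (G n)" if "i \<le> n" for i n
    unfolding P_def using that by (intro borel_measurable_sum adapted) auto
  have max_ineq: "prob {\<omega> \<in> space M. \<exists>i\<le>n. L \<le> \<bar>P i \<omega>\<bar>} \<le> K / L\<^sup>2" if "L > 0" for n L
  proof -
    \<comment> \<open>\<open>T\<close> is \<open>P\<close> stopped on leaving \<open>{-L<..<L}\<close>; a single value of \<open>T\<close> records whether \<open>P\<close> left.\<close>
    define w where "w = (\<lambda>n \<omega>. if \<forall>i\<le>n. \<bar>P i \<omega>\<bar> < L then 1 else 0::real)"
    define T where "T = (\<lambda>n \<omega>. \<Sum>i<n. w i \<omega> * D i \<omega>)"
    have w01: "\<bar>w n \<omega>\<bar> \<le> 1" for n \<omega> by (simp add: w_def)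
    have wG: "w n \<in> borel_measurable (G n)" for n
    proof -
      have [measurable]: "P i \<in> borel_measurable (G n)" if "i \<in> {..n}" for i
        using PG that by auto
      have "w n = (\<lambda>\<omega>. if \<forall>i\<in>{..n}. \<bar>P i \<omega>\<bar> < L then 1 else 0)"
        by (auto simp: w_def fun_eq_iff)
      also have "\<dots> \<in> borel_measurable (G n)" by measurable
      finally show ?thesis .
    qed
    have [measurable]: "w n \<in> borel_measurable M" for n
      using measurable_from_subalg[OF sub wG] .
    have [measurable]: "T n \<in> borel_measurable M" for n
      unfolding T_def by measurable
    have TP: "T n \<omega> = P n \<omega>" if "\<And>i. i < n \<Longrightarrow> \<bar>P i \<omega>\<bar> < L" for n \<omega>
      unfolding T_def P_def by (intro sum.cong) (use that in \<open>auto simp: w_def\<close>)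
    have wTP: "T n \<omega> * w n \<omega> = P n \<omega> * w n \<omega>" for n \<omega>
      using TP[of n \<omega>] by (auto simp: w_def)
    have wT_bdd: "\<bar>P n \<omega> * w n \<omega>\<bar> \<le> L" for n \<omega>
      using that by (auto simp: w_def less_imp_le)
    have stopped: "L \<le> \<bar>T n \<omega>\<bar>" if ex: "\<exists>i\<le>n. L \<le> \<bar>P i \<omega>\<bar>" for n \<omega>
    proof -
      define i where "i = (LEAST i. L \<le> \<bar>P i \<omega>\<bar>)"
      have i: "L \<le> \<bar>P i \<omega>\<bar>" "i \<le> n" "\<And>j. j < i \<Longrightarrow> \<bar>P j \<omega>\<bar> < L"
        unfolding i_def using ex
        by (auto intro: LeastI Least_le[THEN order_trans] dest: not_less_Least simp: not_le[symmetric])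
      have "T n \<omega> = T i \<omega>" unfolding T_def
        by (rule sum.mono_neutral_right) (use i in \<open>auto simp: w_def not_less[symmetric]\<close>)
      also have "\<dots> = P i \<omega>" using i by (intro TP) auto
      finally show ?thesis using i by simp
    qed
    have wD2: "integrable M (\<lambda>\<omega>. (w n \<omega> * D n \<omega>)\<^sup>2)" for n
      by (rule Bochner_Integration.integrable_bound[OF square_int[of n]])
         (auto simp: w_def)
    have T2: "integrable M (\<lambda>\<omega>. (T n \<omega>)\<^sup>2) \<and>
        (\<integral>\<omega>. (T n \<omega>)\<^sup>2 \<partial>M) \<le> (\<Sum>i<n. \<integral>\<omega>. (D i \<omega>)\<^sup>2 \<partial>M)" for n
    proof (induction n)
      case 0
      then show ?case by (simp add: T_def)
    next
      case (Suc n)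
      have Dint: "integrable M (D n)"
        using square_integrable_imp_integrable[OF _ square_int[of n]] by simp
      have Yint: "integrable M (\<lambda>\<omega>. D n \<omega> * (P n \<omega> * w n \<omega>))"
      proof (rule Bochner_Integration.integrable_bound[of _ "\<lambda>\<omega>. L * D n \<omega>"])
        show "AE \<omega> in M. norm (D n \<omega> * (P n \<omega> * w n \<omega>)) \<le> norm (L * D n \<omega>)"
          using mult_left_mono[OF wT_bdd abs_ge_zero] that
          by (intro always_eventually) (simp add: abs_mult mult.commute[of L])
      qed (use Dint in auto)
      have eq: "(T (Suc n) \<omega>)\<^sup>2
          = (T n \<omega>)\<^sup>2 + 2 * (D n \<omega> * (P n \<omega> * w n \<omega>)) + (w n \<omega> * D n \<omega>)\<^sup>2" for \<omega>
        unfolding wTP[symmetric] by (simp add: T_def power2_eq_square algebra_simps)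
      have int: "integrable M (\<lambda>\<omega>. (T (Suc n) \<omega>)\<^sup>2)"
        unfolding eq using Suc Yint wD2 by auto
      have "(\<integral>\<omega>. D n \<omega> * (P n \<omega> * w n \<omega>) \<partial>M) = 0"
        by (rule orth[of _ n L]) (use PG wG wT_bdd in \<open>auto intro!: borel_measurable_times\<close>)
      then have "(\<integral>\<omega>. (T (Suc n) \<omega>)\<^sup>2 \<partial>M)
          = (\<integral>\<omega>. (T n \<omega>)\<^sup>2 \<partial>M) + (\<integral>\<omega>. (w n \<omega> * D n \<omega>)\<^sup>2 \<partial>M)"
        unfolding eq using Suc Yint wD2 by simp
      moreover have "(\<integral>\<omega>. (w n \<omega> * D n \<omega>)\<^sup>2 \<partial>M) \<le> (\<integral>\<omega>. (D n \<omega>)\<^sup>2 \<partial>M)"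
        by (rule integral_mono[OF wD2 square_int]) (auto simp: w_def)
      ultimately show ?case using Suc int by simp
    qed
    have "prob {\<omega> \<in> space M. \<exists>i\<le>n. L \<le> \<bar>P i \<omega>\<bar>} \<le> prob {\<omega> \<in> space M. L\<^sup>2 \<le> (T n \<omega>)\<^sup>2}"
      using stopped that by (intro finite_measure_mono) (auto simp: abs_le_square_iff[symmetric])
    also have "\<dots> \<le> (\<integral>\<omega>. (T n \<omega>)\<^sup>2 \<partial>M) / L\<^sup>2"
      using integral_Markov_inequality_measure[of M "\<lambda>\<omega>. (T n \<omega>)\<^sup>2" "{}" "L\<^sup>2"] T2[of n] that
      by simp
    also have "\<dots> \<le> K / L\<^sup>2"
      using T2[of n] bound[of n] by (intro divide_right_mono) auto
    finally show ?thesis .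
  qed
  define E where "E = (\<lambda>L. {\<omega> \<in> space M. \<exists>i. L \<le> \<bar>P i \<omega>\<bar>})"
  have [measurable]: "E L \<in> sets M" for L unfolding E_def by measurable
  have E_bound: "prob (E L) \<le> K / L\<^sup>2" if "L > 0" for L
  proof -
    have "(\<lambda>n. prob {\<omega> \<in> space M. \<exists>i\<le>n. L \<le> \<bar>P i \<omega>\<bar>})
        \<longlonglongrightarrow> prob (\<Union>n. {\<omega> \<in> space M. \<exists>i\<le>n. L \<le> \<bar>P i \<omega>\<bar>})"
    proof (rule finite_Lim_measure_incseq)
      show "range (\<lambda>n. {\<omega> \<in> space M. \<exists>i\<le>n. L \<le> \<bar>P i \<omega>\<bar>}) \<subseteq> sets M" by auto
      show "incseq (\<lambda>n. {\<omega> \<in> space M. \<exists>i\<le>n. L \<le> \<bar>P i \<omega>\<bar>})"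
        by (rule incseq_SucI) (use le_SucI in blast)
    qed
    also have "(\<Union>n. {\<omega> \<in> space M. \<exists>i\<le>n. L \<le> \<bar>P i \<omega>\<bar>}) = E L" by (auto simp: E_def)
    finally show ?thesis by (rule LIMSEQ_le_const2) (use max_ineq that in auto)
  qed
  define E' where "E' = (\<Inter>l. E (real (Suc l)))"
  have [measurable]: "E' \<in> sets M" unfolding E'_def by measurable
  have "prob E' \<le> K / (real (Suc l))\<^sup>2" for l
  proof -
    have "E' \<subseteq> E (real (Suc l))" unfolding E'_def by blast
    then have "prob E' \<le> prob (E (real (Suc l)))" by (intro finite_measure_mono) auto
    also have "\<dots> \<le> K / (real (Suc l))\<^sup>2" by (rule E_bound) simp
    finally show ?thesis .
  qed
  moreover have "(\<lambda>l. K / (real (Suc l))\<^sup>2) \<longlonglongrightarrow> 0" by real_asymp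
  ultimately have "prob E' \<le> 0" by (intro LIMSEQ_le_const) auto
  then have "E' \<in> null_sets M" by (auto simp: emeasure_eq_measure measure_le_0_iff)
  then have "AE \<omega> in M. \<omega> \<notin> E'" by (rule AE_not_in)
  then show ?thesis
  proof (rule AE_mp, intro AE_I2 impI)
    fix \<omega> assume "\<omega> \<in> space M" "\<omega> \<notin> E'"
    then show "\<exists>B. \<forall>n. \<bar>\<Sum>i<n. D i \<omega>\<bar> \<le> B"
      by (auto simp: E'_def E_def P_def not_le intro: less_imp_le)
  qed
qed

lemma (in prob_space) AE_bounded_sums_nonneg:
  fixes f :: "nat \<Rightarrow> 'a \<Rightarrow> real"
  assumes int: "\<And>n. integrable M (f n)" and nonneg: "\<And>n \<omega>. 0 \<le> f n \<omega>"
    and bound: "\<And>n. (\<Sum>i<n. \<integral>\<omega>. f i \<omega> \<partial>M) \<le> K"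
  shows "AE \<omega> in M. \<exists>B. \<forall>n. (\<Sum>i<n. f i \<omega>) \<le> B"
proof -
  have [measurable]: "f n \<in> borel_measurable M" for n using int by auto
  have "(\<integral>\<^sup>+\<omega>. (\<Sum>n. ennreal (f n \<omega>)) \<partial>M) = (\<Sum>n. \<integral>\<^sup>+\<omega>. ennreal (f n \<omega>) \<partial>M)"
    by (rule nn_integral_suminf) auto
  also have "\<dots> = (\<Sum>n. ennreal (\<integral>\<omega>. f n \<omega> \<partial>M))"
    using int nonneg by (simp add: nn_integral_eq_integral)
  also have "\<dots> \<le> ennreal K"
    using nonneg bound by (intro suminf_le_const) (auto simp: sum_ennreal ennreal_leI)
  finally have "(\<integral>\<^sup>+\<omega>. (\<Sum>n. ennreal (f n \<omega>)) \<partial>M) \<noteq> \<infinity>"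
    by (auto simp: top_unique)
  then have "AE \<omega> in M. (\<Sum>n. ennreal (f n \<omega>)) \<noteq> \<infinity>"
    by (intro nn_integral_PInf_AE) auto
  then show ?thesis
  proof (rule AE_mp, intro AE_I2 impI)
    fix \<omega> assume *: "(\<Sum>n. ennreal (f n \<omega>)) \<noteq> \<infinity>"
    then obtain B where B: "(\<Sum>n. ennreal (f n \<omega>)) = ennreal B" "0 \<le> B"
      by (metis ennreal_cases infinity_ennreal_def)
    have "(\<Sum>i<n. f i \<omega>) \<le> B" for n
    proof -
      have "ennreal (\<Sum>i<n. f i \<omega>) = (\<Sum>i<n. ennreal (f i \<omega>))"
        by (rule sum_ennreal[symmetric]) (rule nonneg)
      also have "\<dots> \<le> (\<Sum>n. ennreal (f n \<omega>))"
        by (rule sum_le_suminf) auto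
      finally show ?thesis using B by (simp add: ennreal_le_iff)
    qed
    then show "\<exists>B. \<forall>n. (\<Sum>i<n. f i \<omega>) \<le> B" by blast
  qed
qed

text \<open>
  If the terms of the decreasing sequence \<open>1 / T n\<close> were summable, \<open>T n\<close> would grow faster than
  linearly; by Fatou's lemma this has probability zero when the means grow at most linearly.
\<close>

lemma (in prob_space) AE_not_summable_inverse:
  fixes T :: "nat \<Rightarrow> 'a \<Rightarrow> real"
  assumes int: "\<And>n. integrable M (T n)" and pos: "\<And>n \<omega>. \<omega> \<in> space M \<Longrightarrow> 0 < T n \<omega>"
    and mono: "\<And>n \<omega>. \<omega> \<in> space M \<Longrightarrow> T n \<omega> \<le> T (Suc n) \<omega>"
    and growth: "\<And>n. (\<integral>\<omega>. T n \<omega> \<partial>M) \<le> K * real (Suc n)"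
  shows "AE \<omega> in M. \<not> summable (\<lambda>n. 1 / T n \<omega>)"
proof -
  have [measurable]: "T n \<in> borel_measurable M" for n using int by auto
  have "0 \<le> (\<integral>\<omega>. T 0 \<omega> \<partial>M)"
    using pos by (intro Bochner_Integration.integral_nonneg_AE AE_I2) (auto intro: less_imp_le)
  then have "0 \<le> K" using growth[of 0] by simp
  \<comment> \<open>The block from \<open>n\<close> to \<open>2 * n\<close> contributes at least \<open>1 / g n\<close> to the series.\<close>
  define g where "g = (\<lambda>n \<omega>. ennreal (T (2 * n) \<omega> / real (Suc n)))"
  have [measurable]: "g n \<in> borel_measurable M" for n unfolding g_def by measurable
  have "(\<integral>\<^sup>+\<omega>. g n \<omega> \<partial>M) \<le> ennreal (2 * K)" for n
  proof -
    have "(\<integral>\<^sup>+\<omega>. g n \<omega> \<partial>M) = ennreal (\<integral>\<omega>. T (2 * n) \<omega> / real (Suc n) \<partial>M)"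
      unfolding g_def using int pos
      by (intro nn_integral_eq_integral AE_I2) (auto intro: less_imp_le)
    also have "(\<integral>\<omega>. T (2 * n) \<omega> / real (Suc n) \<partial>M) \<le> K * real (Suc (2 * n)) / real (Suc n)"
      using growth[of "2 * n"] by (simp add: divide_right_mono)
    also have "\<dots> \<le> 2 * K" using \<open>0 \<le> K\<close> by (simp add: field_simps)
    finally show ?thesis by (simp add: ennreal_leI)
  qed
  then have "liminf (\<lambda>n. \<integral>\<^sup>+\<omega>. g n \<omega> \<partial>M) \<le> ennreal (2 * K)"
    by (intro Liminf_le) auto
  then have "(\<integral>\<^sup>+\<omega>. liminf (\<lambda>n. g n \<omega>) \<partial>M) \<noteq> \<infinity>"
    using nn_integral_liminf[of g M] by (auto simp: top_unique)
  then have "AE \<omega> in M. liminf (\<lambda>n. g n \<omega>) \<noteq> \<infinity>"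
    by (intro nn_integral_PInf_AE) auto
  then show ?thesis
  proof (rule AE_mp, intro AE_I2 impI notI)
    fix \<omega> assume \<omega>: "\<omega> \<in> space M" and fin: "liminf (\<lambda>n. g n \<omega>) \<noteq> \<infinity>"
      and sm: "summable (\<lambda>n. 1 / T n \<omega>)"
    have inc: "T i \<omega> \<le> T n \<omega>" if "i \<le> n" for i n
      using lift_Suc_mono_le[of "\<lambda>n. T n \<omega>", OF mono[OF \<omega>] that] .
    define r where "r = enn2real (liminf (\<lambda>n. g n \<omega>))"
    have r: "liminf (\<lambda>n. g n \<omega>) = ennreal r" "0 \<le> r"
      using fin by (simp_all add: r_def less_top)
    obtain n0 where n0: "\<And>m n. m \<ge> n0 \<Longrightarrow> norm (\<Sum>i=m..<n. 1 / T i \<omega>) < 1 / (r + 1)"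
      using sm r(2) unfolding summable_Cauchy by (metis add_nonneg_pos zero_less_divide_1_iff zero_less_one)
    have "ennreal (r + 1) \<le> g n \<omega>" if "n \<ge> n0" for n
    proof -
      have "real (Suc n) * (1 / T (2 * n) \<omega>) = (\<Sum>i=n..<Suc (2 * n). 1 / T (2 * n) \<omega>)" by simp
      also have "\<dots> \<le> (\<Sum>i=n..<Suc (2 * n). 1 / T i \<omega>)"
        using pos[OF \<omega>] by (intro sum_mono divide_left_mono inc) auto
      also have "\<dots> < 1 / (r + 1)" using n0[OF that, of "Suc (2 * n)"] by simp
      finally have "r + 1 \<le> T (2 * n) \<omega> / real (Suc n)"
        using pos[OF \<omega>, of "2 * n"] r(2) by (simp add: field_simps)
      then show ?thesis unfolding g_def by (rule ennreal_leI)
    qed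
    then have "ennreal (r + 1) \<le> liminf (\<lambda>n. g n \<omega>)"
      by (intro Liminf_bounded) (auto simp: eventually_sequentially)
    then show False using r by simp
  qed
qed

text \<open>
  Only the limit of the weights \<open>c\<close> is positive; the finitely many terms with a weight below \<open>\<delta> / 2\<close>
  are collected in a constant.
\<close>

lemma filterlim_weighted_sums_at_top:
  fixes a c r :: "nat \<Rightarrow> real"
  assumes a: "\<And>n. 0 \<le> a n" "\<not> summable a" and ar: "\<And>n. a n \<le> r n"
    and c: "c \<longlonglongrightarrow> \<delta>" "0 < \<delta>"
  shows "filterlim (\<lambda>n. \<Sum>i<n. c i * r i) at_top sequentially"
proof -
  have "eventually (\<lambda>i. \<delta> / 2 < c i) sequentially"
    using order_tendstoD(1)[OF c(1), of "\<delta> / 2"] c(2) by simp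
  then obtain i0 where i0: "\<And>i. i \<ge> i0 \<Longrightarrow> \<delta> / 2 < c i"
    unfolding eventually_sequentially by auto
  define e where "e = (\<lambda>i. c i * r i - \<delta> / 2 * a i)"
  have e: "0 \<le> e i" if "i \<ge> i0" for i
    using mult_mono[of "\<delta> / 2" "c i" "a i" "r i"] i0[OF that] a(1)[of i] ar[of i] c(2)
    by (simp add: e_def)
  have low: "(\<Sum>i<i0. e i) + \<delta> / 2 * (\<Sum>i<n. a i) \<le> (\<Sum>i<n. c i * r i)" if "n \<ge> i0" for n
  proof -
    have "(\<Sum>i<i0. e i) \<le> (\<Sum>i<n. e i)"
      by (rule sum_mono2) (use that e in auto)
    then show ?thesis by (simp add: e_def sum_subtractf sum_distrib_left)
  qed
  show ?thesis unfolding filterlim_at_top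
  proof
    fix Z :: real
    define B where "B = (Z - (\<Sum>i<i0. e i)) / (\<delta> / 2)"
    obtain n1 where n1: "B < (\<Sum>i\<le>n1. a i)"
      using bounded_imp_summable[of a B] a by (meson not_le)
    have "Z \<le> (\<Sum>i<n. c i * r i)" if "n \<ge> max i0 (Suc n1)" for n
    proof -
      have "(\<Sum>i\<le>n1. a i) \<le> (\<Sum>i<n. a i)"
        by (rule sum_mono2) (use that a in auto)
      then have "B \<le> (\<Sum>i<n. a i)" using n1 by simp
      then have "Z - (\<Sum>i<i0. e i) \<le> \<delta> / 2 * (\<Sum>i<n. a i)"
        using c(2) unfolding B_def by (subst (asm) pos_divide_le_eq) (auto simp: mult.commute)
      then show ?thesis using low[of n] that by simp
    qed
    then show "eventually (\<lambda>n. Z \<le> (\<Sum>i<n. c i * r i)) sequentially"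
      unfolding eventually_sequentially by blast
  qed
qed

lemma ln_one_plus_lower_bound:
  fixes x :: real
  assumes "0 \<le> x"
  shows "x - x\<^sup>2 \<le> ln (1 + x)"
proof (cases "x \<le> 1")
  case True
  then show ?thesis using assms by (intro ln_one_plus_pos_lower_bound)
next
  case False
  then have "x - x\<^sup>2 \<le> 0" by (simp add: power2_eq_square)
  also have "0 \<le> ln (1 + x)" using assms by simp
  finally show ?thesis .
qed

lemma (in finite_measure) integrable_AE_bounded_mult:
  fixes f g :: "'a \<Rightarrow> real"
  assumes "f \<in> borel_measurable M" "g \<in> borel_measurable M"
    and "AE \<omega> in M. \<bar>f \<omega>\<bar> \<le> a" and "AE \<omega> in M. \<bar>g \<omega>\<bar> \<le> b"
  shows "integrable M (\<lambda>\<omega>. f \<omega> * g \<omega>)"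
proof (rule integrable_const_bound[where B = "a * b"])
  show "AE \<omega> in M. norm (f \<omega> * g \<omega>) \<le> a * b"
    using assms(3,4) by eventually_elim (simp add: abs_mult mult_mono')
qed (use assms in simp)

section \<open>Sigma-fields of the urn process\<close>

lemma subalgebra_sigmaI: "S \<subseteq> sets M \<Longrightarrow> subalgebra M (sigma (space M) S)"
  unfolding subalgebra_def
  by (metis sets.sigma_sets_subset sets.space_closed sets_measure_of space_measure_of subset_trans)

lemma generators_subset_sigma: "S \<subseteq> sets M \<Longrightarrow> S \<subseteq> sets (sigma (space M) S)"
  by (metis sets.space_closed sets_measure_of sigma_sets_superset_generator subset_trans)

lemma sets_vec_alg_subset:
  "(\<And>k. k \<in> {1..d} \<Longrightarrow> Y k \<in> measurable M E) \<Longrightarrow> sets (vec_alg M d E Y) \<subseteq> sets M"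
  unfolding vec_alg_def by (intro sets_image_in_sets measurable_restrict) auto

lemma measurable_vec_alg_component:
  assumes "sets (vec_alg M d E Y) \<subseteq> sets K" "space K = space M" "space E = UNIV" "k \<in> {1..d}"
  shows "Y k \<in> measurable K E"
proof -
  have "(\<lambda>\<omega>. \<lambda>k\<in>{1..d}. Y k \<omega>) \<in> measurable (vec_alg M d E Y) (\<Pi>\<^sub>M k\<in>{1..d}. E)"
    unfolding vec_alg_def using assms
    by (intro measurable_vimage_algebra1) (auto simp: space_PiM)
  from measurable_compose[OF this measurable_component_singleton[OF assms(4)]]
  have "Y k \<in> measurable (vec_alg M d E Y) E" using assms(4) by simp
  moreover have "subalgebra K (vec_alg M d E Y)"
    using assms by (simp add: subalgebra_def vec_alg_def)
  ultimately show ?thesis by (rule measurable_from_subalg[rotated])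
qed

context multidraw_urn
begin

lemma sets_vimage_N_subset:
  "n \<ge> 1 \<Longrightarrow> sets (vimage_algebra (space M) (N n) (count_space UNIV)) \<subseteq> sets M"
  by (intro sets_image_in_sets N_measurable) auto

lemma F_generators: "(\<Union>i\<in>{1..n}. sets (vimage_algebra (space M) (N i) (count_space UNIV))
        \<union> sets (vec_alg M d (count_space UNIV) (X i))
        \<union> sets (vec_alg M d borel (A i))) \<subseteq> sets M"
  using sets_vimage_N_subset sets_vec_alg_subset[OF X_measurable] sets_vec_alg_subset[OF A_measurable]
  by (intro UN_least Un_least) auto

abbreviation "G \<equiv> urn_G M d N X A"

lemma subalgebra_F: "subalgebra M (urn_F M d N X A n)"
  unfolding urn_F_def by (rule subalgebra_sigmaI[OF F_generators])

lemma G_generators: "sets (urn_F M d N X A n)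
        \<union> sets (vimage_algebra (space M) (N (Suc n)) (count_space UNIV)) \<subseteq> sets M"
  using subalgebra_F sets_vimage_N_subset[of "Suc n"] by (auto simp: subalgebra_def)

lemma subalgebra_G: "subalgebra M (G n)"
  unfolding urn_G_def by (rule subalgebra_sigmaI[OF G_generators])

lemma space_G: "space (G n) = space M"
  using subalgebra_G by (auto simp: subalgebra_def)

lemma F_generators_subset_G:
  assumes "i \<in> {1..n}"
  shows "sets (vec_alg M d (count_space UNIV) (X i)) \<subseteq> sets (G n)"
    and "sets (vec_alg M d borel (A i)) \<subseteq> sets (G n)"
    and "sets (vimage_algebra (space M) (N i) (count_space UNIV)) \<subseteq> sets (G n)"
proof -
  have "(\<Union>i\<in>{1..n}. sets (vimage_algebra (space M) (N i) (count_space UNIV))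
        \<union> sets (vec_alg M d (count_space UNIV) (X i))
        \<union> sets (vec_alg M d borel (A i))) \<subseteq> sets (urn_F M d N X A n)"
    unfolding urn_F_def by (rule generators_subset_sigma[OF F_generators])
  also have "\<dots> \<subseteq> sets (G n)"
    using generators_subset_sigma[OF G_generators, of n] unfolding urn_G_def by simp
  finally show "sets (vec_alg M d (count_space UNIV) (X i)) \<subseteq> sets (G n)"
    "sets (vec_alg M d borel (A i)) \<subseteq> sets (G n)"
    "sets (vimage_algebra (space M) (N i) (count_space UNIV)) \<subseteq> sets (G n)"
    using assms by (simp_all add: UN_subset_iff)
qed

lemma N_G:
  assumes "i \<in> {1..Suc n}"
  shows "N i \<in> measurable (G n) (count_space UNIV)"
proof (rule measurable_from_subalg[OF _ measurable_vimage_algebra1])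
  have "sets (vimage_algebra (space M) (N i) (count_space UNIV)) \<subseteq> sets (G n)"
  proof (cases "i = Suc n")
    case True
    then show ?thesis
      using generators_subset_sigma[OF G_generators, of n] unfolding urn_G_def by simp
  next
    case False
    then show ?thesis
      using F_generators_subset_G(3)[of i n] assms by simp
  qed
  then show "subalgebra (G n) (vimage_algebra (space M) (N i) (count_space UNIV))"
    using space_G[of n] by (simp add: subalgebra_def)
qed auto

lemma X_G: "i \<in> {1..n} \<Longrightarrow> k \<in> {1..d} \<Longrightarrow> X i k \<in> measurable (G n) (count_space UNIV)"
  by (rule measurable_vec_alg_component[OF F_generators_subset_G(1)]) (auto simp: space_G)

lemma A_G: "i \<in> {1..n} \<Longrightarrow> k \<in> {1..d} \<Longrightarrow> A i k \<in> borel_measurable (G n)"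
  by (rule measurable_vec_alg_component[OF F_generators_subset_G(2)]) (auto simp: space_G)

lemma H_G:
  assumes "i \<le> n" "k \<in> {1..d}"
  shows "(\<lambda>\<omega>. real (H i k \<omega>)) \<in> borel_measurable (G n)"
proof -
  have [measurable]: "X i k \<in> measurable (G n) (count_space UNIV)" "A i k \<in> borel_measurable (G n)"
    if "i \<in> {1..n}" for i
    using X_G A_G assms that by auto
  have "(\<lambda>\<omega>. real (H0 k) + (\<Sum>j=1..i. A j k \<omega> * real (X j k \<omega>))) \<in> borel_measurable (G n)"
    using assms(1)
    by (intro borel_measurable_add borel_measurable_const borel_measurable_sum
        borel_measurable_times measurable_compose[OF _ measurable_count_space]) auto
  then show ?thesis
    by (rule measurable_cong[THEN iffD2, rotated]) (use composition assms in \<open>auto simp: space_G\<close>)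
qed

lemma total_G: "i \<le> n \<Longrightarrow> (\<lambda>\<omega>. real (total d H i \<omega>)) \<in> borel_measurable (G n)"
  unfolding total_def of_nat_sum by (intro borel_measurable_sum H_G) auto

text \<open>
  The sigma-field generated by \<open>G\<^sub>n\<close> and the draw at stage \<open>n + 1\<close>; the replacements at stage
  \<open>n + 1\<close> are independent of it.
\<close>

definition draw_alg :: "nat \<Rightarrow> 'a measure" where
  "draw_alg n = sigma (space M) (sets (G n) \<union> sets (vec_alg M d (count_space UNIV) (X (Suc n))))"

lemma draw_generators:
  "sets (G n) \<union> sets (vec_alg M d (count_space UNIV) (X (Suc n))) \<subseteq> sets M"
  using subalgebra_G[of n] sets_vec_alg_subset[where Y = "X (Suc n)", OF X_measurable[of "Suc n"]]
  by (auto simp: subalgebra_def)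

lemma subalgebra_draw_alg: "subalgebra M (draw_alg n)"
  unfolding draw_alg_def by (rule subalgebra_sigmaI[OF draw_generators])

lemma space_draw_alg: "space (draw_alg n) = space M"
  using subalgebra_draw_alg by (auto simp: subalgebra_def)

lemma G_draw_alg: "Y \<in> measurable (G n) E \<Longrightarrow> Y \<in> measurable (draw_alg n) E"
  by (rule measurable_from_subalg)
    (use generators_subset_sigma[OF draw_generators, of n] in
      \<open>auto simp: subalgebra_def space_G space_draw_alg draw_alg_def[symmetric]\<close>)

lemma X_draw_alg: "k \<in> {1..d} \<Longrightarrow> X (Suc n) k \<in> measurable (draw_alg n) (count_space UNIV)"
  by (rule measurable_vec_alg_component)
    (use generators_subset_sigma[OF draw_generators, of n] in
      \<open>auto simp: space_draw_alg draw_alg_def[symmetric]\<close>)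

lemma indep_replacement:
  fixes \<phi> :: "real \<Rightarrow> real" and W :: "'a \<Rightarrow> real"
  assumes "k \<in> {1..d}" "\<phi> \<in> borel_measurable borel" "W \<in> borel_measurable (draw_alg n)"
  shows "indep_var borel (\<lambda>\<omega>. \<phi> (A (Suc n) k \<omega>)) borel W"
proof -
  let ?V = "vec_alg M d borel (A (Suc n))"
  have V: "subalgebra M ?V"
    using sets_vec_alg_subset[where Y = "A (Suc n)", OF A_measurable[of "Suc n"]]
    by (simp add: subalgebra_def vec_alg_def)
  have "A (Suc n) k \<in> borel_measurable ?V"
    using V assms(1) by (intro measurable_vec_alg_component) (auto simp: subalgebra_def)
  then have \<phi>V: "(\<lambda>\<omega>. \<phi> (A (Suc n) k \<omega>)) \<in> borel_measurable ?V"
    using assms(2) by (rule measurable_compose)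
  have gen: "sigma_sets (space M) {f -` B \<inter> space M |B. B \<in> sets borel} \<subseteq> sets K"
    if "space K = space M" "f \<in> borel_measurable K" for f :: "'a \<Rightarrow> real" and K
    unfolding that(1)[symmetric] using measurable_sets[OF that(2)]
    by (intro sets.sigma_sets_subset) auto
  have "indep_set (sets ?V) (sets (draw_alg n))"
    using replacement_indep unfolding draw_alg_def .
  then have "indep_set
      (sigma_sets (space M) {(\<lambda>\<omega>. \<phi> (A (Suc n) k \<omega>)) -` B \<inter> space M |B. B \<in> sets borel})
      (sigma_sets (space M) {W -` B \<inter> space M |B. B \<in> sets borel})"
    using gen[OF _ \<phi>V] gen[OF space_draw_alg assms(3)] V
    unfolding indep_sets2_eq subalgebra_def by (meson subset_eq)
  then show ?thesis
    unfolding indep_var_eq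
    using measurable_from_subalg[OF V \<phi>V] measurable_from_subalg[OF subalgebra_draw_alg assms(3)]
    by auto
qed

section \<open>Draws and composition of the urn\<close>

lemma AE_sample_size:
  "AE \<omega> in M. \<forall>n. 1 \<le> N (Suc n) \<omega> \<and> N (Suc n) \<omega> \<le> total d H n \<omega> \<and> real (N (Suc n) \<omega>) \<le> C1"
proof (subst AE_all_countable, intro allI)
  fix n
  show "AE \<omega> in M. 1 \<le> N (Suc n) \<omega> \<and> N (Suc n) \<omega> \<le> total d H n \<omega> \<and> real (N (Suc n) \<omega>) \<le> C1"
    using sample_size[of n]
  proof (rule AE_mp, intro AE_I2 impI)
    fix \<omega> assume "real (N (Suc n) \<omega>) \<in> (\<lambda>j. min (real j) C1) ` {1..total d H n \<omega>}"
    then obtain j where j: "real (N (Suc n) \<omega>) = min (real j) C1" "1 \<le> j" "j \<le> total d H n \<omega>" by auto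
    then have "0 < real (N (Suc n) \<omega>)" "real (N (Suc n) \<omega>) \<le> real j" "real (N (Suc n) \<omega>) \<le> C1"
      using C1_pos by auto
    then show "1 \<le> N (Suc n) \<omega> \<and> N (Suc n) \<omega> \<le> total d H n \<omega> \<and> real (N (Suc n) \<omega>) \<le> C1"
      using j by auto
  qed
qed

text \<open>The event that the draw at stage \<open>n + 1\<close> has composition \<open>x\<close>.\<close>

definition draw_event :: "nat \<Rightarrow> (nat \<Rightarrow> nat) \<Rightarrow> 'a set" where
  "draw_event n x = {\<omega> \<in> space M. \<forall>k\<in>{1..d}. X (Suc n) k \<omega> = x k}"

lemma draw_event_sets [measurable]: "draw_event n x \<in> sets M"
proof -
  have [measurable]: "X (Suc n) k \<in> measurable M (count_space UNIV)" if "k \<in> {1..d}" for k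
    using X_measurable that by auto
  show ?thesis unfolding draw_event_def by measurable
qed

lemma draw_event_integral:
  fixes Y :: "'a \<Rightarrow> real"
  assumes Y: "Y \<in> borel_measurable (G n)" and bdd: "\<And>\<omega>. \<omega> \<in> space M \<Longrightarrow> \<bar>Y \<omega>\<bar> \<le> c"
  shows "integrable M (\<lambda>\<omega>. Y \<omega> * indicator (draw_event n x) \<omega>)"
    and "integrable M (\<lambda>\<omega>. Y \<omega> * real_cond_exp M (G n) (indicator (draw_event n x)) \<omega>)"
    and "(\<integral>\<omega>. Y \<omega> * real_cond_exp M (G n) (indicator (draw_event n x)) \<omega> \<partial>M)
       = (\<integral>\<omega>. Y \<omega> * indicator (draw_event n x) \<omega> \<partial>M)"
proof -
  interpret finite_measure_subalgebra M "G n"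
    by standard (rule subalgebra_G)
  have [measurable]: "Y \<in> borel_measurable M"
    using measurable_from_subalg[OF subalgebra_G Y] .
  show int: "integrable M (\<lambda>\<omega>. Y \<omega> * indicator (draw_event n x) \<omega>)"
  proof (rule integrable_const_bound[where B = c])
    show "AE \<omega> in M. norm (Y \<omega> * indicator (draw_event n x) \<omega>) \<le> c"
      using bdd by (intro AE_I2) (force simp: indicator_def intro: order_trans[OF abs_ge_zero])
  qed simp
  show "integrable M (\<lambda>\<omega>. Y \<omega> * real_cond_exp M (G n) (indicator (draw_event n x)) \<omega>)"
    "(\<integral>\<omega>. Y \<omega> * real_cond_exp M (G n) (indicator (draw_event n x)) \<omega> \<partial>M)
       = (\<integral>\<omega>. Y \<omega> * indicator (draw_event n x) \<omega> \<partial>M)"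
    using real_cond_exp_intg[OF int Y] by simp_all
qed

lemma draw_event_cond_exp:
  "AE \<omega> in M. \<forall>x\<in>{1..d} \<rightarrow>\<^sub>E UNIV. real_cond_exp M (G n) (indicator (draw_event n x)) \<omega>
     = multi_hypergeom_prob d (total d H n \<omega>) (N (Suc n) \<omega>) (\<lambda>k. H n k \<omega>) x"
  using draw_hypergeometric by (intro AE_ball_countable' countable_PiE) (auto simp: draw_event_def)

text \<open>
  The hypergeometric law gives probability zero to each of the countably many compositions whose sum
  differs from the sample size.
\<close>

lemma AE_draw_size: "AE \<omega> in M. \<forall>n. (\<Sum>k=1..d. X (Suc n) k \<omega>) = N (Suc n) \<omega>"
proof (subst AE_all_countable, intro allI)
  fix n
  have "AE \<omega> in M. \<omega> \<in> draw_event n x \<longrightarrow> (\<Sum>k=1..d. x k) = N (Suc n) \<omega>"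
    if x: "x \<in> {1..d} \<rightarrow>\<^sub>E UNIV" for x :: "nat \<Rightarrow> nat"
  proof -
    define Y where "Y = (\<lambda>\<omega>. if N (Suc n) \<omega> = (\<Sum>k=1..d. x k) then 0 else 1 :: real)"
    have Y: "Y \<in> borel_measurable (G n)"
      unfolding Y_def using N_G[of "Suc n" n] by measurable
    have "(\<integral>\<omega>. Y \<omega> * indicator (draw_event n x) \<omega> \<partial>M)
        = (\<integral>\<omega>. Y \<omega> * real_cond_exp M (G n) (indicator (draw_event n x)) \<omega> \<partial>M)"
      by (rule draw_event_integral(3)[symmetric, OF Y, of 1]) (simp add: Y_def)
    also have "\<dots> = 0"
      by (rule integral_eq_zero_AE, rule AE_mp[OF draw_event_cond_exp[of n]])
        (use x in \<open>auto simp: Y_def multi_hypergeom_prob_def\<close>)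
    finally have "AE \<omega> in M. Y \<omega> * indicator (draw_event n x) \<omega> = 0"
      by (subst (asm) integral_nonneg_eq_0_iff_AE[OF draw_event_integral(1)[OF Y, of 1]])
        (auto simp: Y_def)
    then show ?thesis by eventually_elim (auto simp: Y_def split: if_splits)
  qed
  then have "AE \<omega> in M. \<forall>x\<in>{1..d} \<rightarrow>\<^sub>E UNIV.
      \<omega> \<in> draw_event n x \<longrightarrow> (\<Sum>k=1..d. x k) = N (Suc n) \<omega>"
    by (intro AE_ball_countable' countable_PiE) auto
  then show "AE \<omega> in M. (\<Sum>k=1..d. X (Suc n) k \<omega>) = N (Suc n) \<omega>"
  proof (rule AE_mp, intro AE_I2 impI)
    fix \<omega> assume *: "\<omega> \<in> space M" "\<forall>x\<in>{1..d} \<rightarrow>\<^sub>E UNIV.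
      \<omega> \<in> draw_event n x \<longrightarrow> (\<Sum>k=1..d. x k) = N (Suc n) \<omega>"
    let ?x = "\<lambda>k\<in>{1..d}. X (Suc n) k \<omega>"
    have "?x \<in> {1..d} \<rightarrow>\<^sub>E UNIV" "\<omega> \<in> draw_event n ?x"
      using *(1) by (auto simp: draw_event_def)
    with *(2) have "(\<Sum>k=1..d. ?x k) = N (Suc n) \<omega>" by blast
    then show "(\<Sum>k=1..d. X (Suc n) k \<omega>) = N (Suc n) \<omega>" by simp
  qed
qed

lemma AE_X_le: "AE \<omega> in M. \<forall>n. \<forall>k\<in>{1..d}. real (X (Suc n) k \<omega>) \<le> C1"
  using AE_sample_size AE_draw_size
proof eventually_elim
  case (elim \<omega>)
  show ?case
  proof (intro allI ballI)
    fix n k assume "k \<in> {1..d}"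
    then have "X (Suc n) k \<omega> \<le> (\<Sum>k=1..d. X (Suc n) k \<omega>)"
      by (intro member_le_sum) auto
    then show "real (X (Suc n) k \<omega>) \<le> C1"
      using elim by (metis of_nat_le_iff order_trans)
  qed
qed

lemma H_0: "k \<in> {1..d} \<Longrightarrow> \<omega> \<in> space M \<Longrightarrow> real (H 0 k \<omega>) = real (H0 k)"
  using composition[of k \<omega> 0] by simp

lemma H_Suc:
  "k \<in> {1..d} \<Longrightarrow> \<omega> \<in> space M \<Longrightarrow>
    real (H (Suc n) k \<omega>) = real (H n k \<omega>) + A (Suc n) k \<omega> * real (X (Suc n) k \<omega>)"
  using composition[of k \<omega> n] composition[of k \<omega> "Suc n"] by simp

lemma H_mono:
  assumes "k \<in> {1..d}" "\<omega> \<in> space M"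
  shows "real (H n k \<omega>) + real (X (Suc n) k \<omega>) \<le> real (H (Suc n) k \<omega>)"
  using H_Suc[OF assms, of n] mult_right_mono[OF replacement_ge_1[of "Suc n" k \<omega>], of "real (X (Suc n) k \<omega>)"]
    assms by simp

lemma H_ge_1:
  assumes "k \<in> {1..d}" "\<omega> \<in> space M"
  shows "1 \<le> H n k \<omega>"
proof (induction n)
  case 0
  then show ?case using H_0[OF assms] initial_pos[OF assms(1)] by simp
next
  case (Suc n)
  then show ?case using H_mono[OF assms, of n] by linarith
qed

text \<open>
  Given \<open>G\<^sub>n\<close>, the mean number of balls of colour \<open>k\<close> in the draw is \<open>N\<^sub>n\<^sub>+\<^sub>1 H\<^sub>n\<^sub>k / S\<^sub>n\<close>. The
  conditional mean is tested against bounded \<open>G\<^sub>n\<close>-measurable \<open>Y\<close>.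
\<close>

lemma draw_mean:
  fixes Y :: "'a \<Rightarrow> real"
  assumes k: "k \<in> {1..d}"
    and Y: "Y \<in> borel_measurable (G n)" and bdd: "\<And>\<omega>. \<omega> \<in> space M \<Longrightarrow> \<bar>Y \<omega>\<bar> \<le> c"
  shows "(\<integral>\<omega>. Y \<omega> * real (X (Suc n) k \<omega>) \<partial>M)
    = (\<integral>\<omega>. Y \<omega> * (real (N (Suc n) \<omega>) * real (H n k \<omega>) / real (total d H n \<omega>)) \<partial>M)"
proof -
  define C where "C = nat \<lfloor>C1\<rfloor>"
  have le_C: "i \<le> C" if "real i \<le> C1" for i :: nat
    using that unfolding C_def by linarith
  let ?P = "{1..d} \<rightarrow>\<^sub>E {..C}"
  have fin: "finite ?P" by (simp add: finite_PiE)
  let ?p = "\<lambda>x. real_cond_exp M (G n) (indicator (draw_event n x))"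
  have [measurable]: "X (Suc n) k \<in> measurable M (count_space UNIV)"
    using X_measurable k by simp
  have [measurable]: "Y \<in> borel_measurable M"
    using measurable_from_subalg[OF subalgebra_G Y] .
  have [measurable]: "N (Suc n) \<in> measurable M (count_space UNIV)"
    "(\<lambda>\<omega>. real (H n k \<omega>)) \<in> borel_measurable M"
    "(\<lambda>\<omega>. real (total d H n \<omega>)) \<in> borel_measurable M"
    using measurable_from_subalg[OF subalgebra_G N_G[of "Suc n" n]]
      measurable_from_subalg[OF subalgebra_G H_G[OF order_refl k]]
      measurable_from_subalg[OF subalgebra_G total_G[OF order_refl]]
    by simp_all
  have "(\<integral>\<omega>. Y \<omega> * real (X (Suc n) k \<omega>) \<partial>M)
      = (\<integral>\<omega>. (\<Sum>x\<in>?P. real (x k) * (Y \<omega> * indicator (draw_event n x) \<omega>)) \<partial>M)"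
  proof (rule integral_cong_AE)
    show "AE \<omega> in M. Y \<omega> * real (X (Suc n) k \<omega>)
        = (\<Sum>x\<in>?P. real (x k) * (Y \<omega> * indicator (draw_event n x) \<omega>))"
      using AE_X_le
    proof (rule AE_mp, intro AE_I2 impI)
      fix \<omega> assume \<omega>: "\<omega> \<in> space M" and le: "\<forall>n. \<forall>k\<in>{1..d}. real (X (Suc n) k \<omega>) \<le> C1"
      let ?x = "\<lambda>k\<in>{1..d}. X (Suc n) k \<omega>"
      have x: "?x \<in> ?P" using le le_C by auto
      have "(\<Sum>x\<in>?P. real (x k) * (Y \<omega> * indicator (draw_event n x) \<omega>))
          = (\<Sum>x\<in>{?x}. real (x k) * (Y \<omega> * indicator (draw_event n x) \<omega>))"
      proof (rule sum.mono_neutral_right[OF fin])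
        have "x = ?x" if "x \<in> ?P" "\<omega> \<in> draw_event n x" for x
          using that by (intro PiE_ext[of x "{1..d}" "\<lambda>_. UNIV"]) (auto simp: draw_event_def PiE_iff)
        then show "\<forall>x\<in>?P - {?x}. real (x k) * (Y \<omega> * indicator (draw_event n x) \<omega>) = 0"
          by (auto simp: indicator_def)
      qed (use x in auto)
      also have "\<dots> = Y \<omega> * real (X (Suc n) k \<omega>)"
        using \<omega> k by (simp add: draw_event_def)
      finally show "Y \<omega> * real (X (Suc n) k \<omega>)
          = (\<Sum>x\<in>?P. real (x k) * (Y \<omega> * indicator (draw_event n x) \<omega>))" ..
    qed
  qed measurable
  also have "\<dots> = (\<Sum>x\<in>?P. real (x k) * (\<integral>\<omega>. Y \<omega> * indicator (draw_event n x) \<omega> \<partial>M))"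
    using draw_event_integral(1)[OF Y bdd] by (subst Bochner_Integration.integral_sum) auto
  also have "\<dots> = (\<Sum>x\<in>?P. real (x k) * (\<integral>\<omega>. Y \<omega> * ?p x \<omega> \<partial>M))"
    using draw_event_integral(3)[OF Y bdd] by simp
  also have "\<dots> = (\<integral>\<omega>. (\<Sum>x\<in>?P. real (x k) * (Y \<omega> * ?p x \<omega>)) \<partial>M)"
    using draw_event_integral(2)[OF Y bdd] by (subst Bochner_Integration.integral_sum) auto
  also have "\<dots> = (\<integral>\<omega>. Y \<omega> * (real (N (Suc n) \<omega>) * real (H n k \<omega>) / real (total d H n \<omega>)) \<partial>M)"
  proof (rule integral_cong_AE)
    show "AE \<omega> in M. (\<Sum>x\<in>?P. real (x k) * (Y \<omega> * ?p x \<omega>))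
        = Y \<omega> * (real (N (Suc n) \<omega>) * real (H n k \<omega>) / real (total d H n \<omega>))"
      using draw_event_cond_exp[of n] AE_sample_size
    proof eventually_elim
      case (elim \<omega>)
      let ?q = "multi_hypergeom_prob d (total d H n \<omega>) (N (Suc n) \<omega>) (\<lambda>k. H n k \<omega>)"
      have "(\<Sum>x\<in>?P. real (x k) * (Y \<omega> * ?p x \<omega>)) = (\<Sum>x\<in>?P. real (x k) * (Y \<omega> * ?q x))"
        by (intro sum.cong refl arg_cong2[where f = "(*)"] elim(1)[rule_format])
          (auto simp: PiE_iff)
      also have "\<dots> = Y \<omega> * (\<Sum>x\<in>?P. real (x k) * ?q x)"
        by (simp add: sum_distrib_left mult.left_commute)
      also have "(\<Sum>x\<in>?P. real (x k) * ?q x)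
          = real (N (Suc n) \<omega>) * real (H n k \<omega>) / real (total d H n \<omega>)"
        using elim(2) le_C by (intro multi_hypergeom_mean k) (auto simp: total_def)
      finally show ?case .
    qed
  qed (use draw_event_integral(2)[OF Y bdd] in \<open>auto intro!: borel_measurable_sum borel_measurable_times\<close>)
  finally show ?thesis .
qed

section \<open>Growth of a single colour\<close>

text \<open>The draw of colour \<open>k\<close> at stage \<open>n + 1\<close>, relative to the number of balls of that colour.\<close>

definition draw_ratio :: "nat \<Rightarrow> nat \<Rightarrow> 'a \<Rightarrow> real" where
  "draw_ratio n k \<omega> = real (X (Suc n) k \<omega>) / real (H n k \<omega>)"

text \<open>
  The proportion of the urn drawn at stage \<open>n + 1\<close>; the conditional mean
  of \<open>draw_ratio n k\<close> given \<open>G\<^sub>n\<close>, for every colour \<open>k\<close>.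
\<close>

definition size_ratio :: "nat \<Rightarrow> 'a \<Rightarrow> real" where
  "size_ratio n \<omega> = real (N (Suc n) \<omega>) / real (total d H n \<omega>)"

text \<open>The relative increase of colour \<open>k\<close> at stage \<open>n + 1\<close>.\<close>

definition growth :: "nat \<Rightarrow> nat \<Rightarrow> 'a \<Rightarrow> real" where
  "growth n k \<omega> = A (Suc n) k \<omega> * draw_ratio n k \<omega>"

text \<open>
  The martingale difference \<open>growth n k - E[growth n k | G\<^sub>n]\<close>, with the conditional mean written
  out explicitly.
\<close>

definition innovation :: "nat \<Rightarrow> nat \<Rightarrow> 'a \<Rightarrow> real" where
  "innovation n k \<omega> = growth n k \<omega> - expectation (A (Suc n) k) * size_ratio n \<omega>"

lemma draw_ratio_nonneg: "0 \<le> draw_ratio n k \<omega>"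
  by (simp add: draw_ratio_def)

lemma size_ratio_nonneg: "0 \<le> size_ratio n \<omega>"
  by (simp add: size_ratio_def)

lemma draw_ratio_measurable:
  assumes "k \<in> {1..d}"
  shows "draw_ratio n k \<in> borel_measurable (draw_alg n)"
    and "n < m \<Longrightarrow> draw_ratio n k \<in> borel_measurable (G m)"
    and "draw_ratio n k \<in> borel_measurable M"
proof -
  have real: "real \<in> measurable (count_space UNIV) borel" by simp
  show 1: "draw_ratio n k \<in> borel_measurable (draw_alg n)"
    unfolding draw_ratio_def
    using measurable_compose[OF X_draw_alg[OF assms] real] G_draw_alg[OF H_G[OF order_refl assms]]
    by (rule borel_measurable_divide)
  show "draw_ratio n k \<in> borel_measurable (G m)" if "n < m"
    unfolding draw_ratio_def
    using measurable_compose[OF X_G[OF _ assms] real] H_G[OF _ assms] that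
    by (intro borel_measurable_divide) auto
  show "draw_ratio n k \<in> borel_measurable M"
    using measurable_from_subalg[OF subalgebra_draw_alg 1] .
qed

lemma size_ratio_measurable:
  shows "n \<le> m \<Longrightarrow> size_ratio n \<in> borel_measurable (G m)"
    and "size_ratio n \<in> borel_measurable M"
proof -
  have real: "real \<in> measurable (count_space UNIV) borel" by simp
  show 1: "size_ratio n \<in> borel_measurable (G m)" if "n \<le> m" for m
    unfolding size_ratio_def
    using measurable_compose[OF N_G real] total_G that by (intro borel_measurable_divide) auto
  show "size_ratio n \<in> borel_measurable M"
    using measurable_from_subalg[OF subalgebra_G 1[OF order_refl]] .
qed

lemma innovation_adapted:
  assumes "k \<in> {1..d}" "i < n"
  shows "innovation i k \<in> borel_measurable (G n)"
proof -
  have "(\<lambda>\<omega>. A (Suc i) k \<omega> * draw_ratio i k \<omega>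
      - expectation (A (Suc i) k) * size_ratio i \<omega>) \<in> borel_measurable (G n)"
    using assms A_G[OF _ assms(1)] draw_ratio_measurable(2) size_ratio_measurable(1)
    by (intro borel_measurable_diff borel_measurable_times borel_measurable_const) auto
  then show ?thesis by (simp only: innovation_def[abs_def] growth_def)
qed

lemma AE_draw_ratio_le:
  assumes "k \<in> {1..d}"
  shows "AE \<omega> in M. draw_ratio n k \<omega> \<le> C1"
  using AE_X_le
proof (rule AE_mp, intro AE_I2 impI)
  fix \<omega> assume \<omega>: "\<omega> \<in> space M" and "\<forall>n. \<forall>k\<in>{1..d}. real (X (Suc n) k \<omega>) \<le> C1"
  then have "real (X (Suc n) k \<omega>) \<le> C1" "1 \<le> real (H n k \<omega>)"
    using assms H_ge_1[OF assms \<omega>, of n] by auto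
  then show "draw_ratio n k \<omega> \<le> C1"
    using C1_pos mult_left_mono[of 1 "real (H n k \<omega>)" C1]
    unfolding draw_ratio_def by (subst pos_divide_le_eq) linarith+
qed

lemma AE_size_ratio_le: "AE \<omega> in M. size_ratio n \<omega> \<le> 1"
  using AE_sample_size
  by eventually_elim (auto simp: size_ratio_def divide_le_eq_1)

lemma draw_ratio_mean:
  fixes Y :: "'a \<Rightarrow> real"
  assumes k: "k \<in> {1..d}"
    and Y: "Y \<in> borel_measurable (G n)" and bdd: "\<And>\<omega>. \<omega> \<in> space M \<Longrightarrow> \<bar>Y \<omega>\<bar> \<le> c"
  shows "(\<integral>\<omega>. draw_ratio n k \<omega> * Y \<omega> \<partial>M) = (\<integral>\<omega>. size_ratio n \<omega> * Y \<omega> \<partial>M)"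
proof -
  define Y' where "Y' = (\<lambda>\<omega>. Y \<omega> / real (H n k \<omega>))"
  have Y': "Y' \<in> borel_measurable (G n)"
    unfolding Y'_def using Y H_G[OF order_refl k] by (rule borel_measurable_divide)
  have bdd': "\<bar>Y' \<omega>\<bar> \<le> c" if "\<omega> \<in> space M" for \<omega>
  proof -
    have "\<bar>Y' \<omega>\<bar> \<le> \<bar>Y \<omega>\<bar> / 1"
      unfolding Y'_def abs_divide using H_ge_1[OF k that, of n] by (intro divide_left_mono) auto
    then show ?thesis using bdd[OF that] by simp
  qed
  have "(\<integral>\<omega>. draw_ratio n k \<omega> * Y \<omega> \<partial>M) = (\<integral>\<omega>. Y' \<omega> * real (X (Suc n) k \<omega>) \<partial>M)"
    by (simp add: draw_ratio_def Y'_def mult.commute)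
  also have "\<dots> = (\<integral>\<omega>. Y' \<omega> * (real (N (Suc n) \<omega>) * real (H n k \<omega>) / real (total d H n \<omega>)) \<partial>M)"
    by (rule draw_mean[OF k Y' bdd'])
  also have "\<dots> = (\<integral>\<omega>. size_ratio n \<omega> * Y \<omega> \<partial>M)"
  proof (rule Bochner_Integration.integral_cong[OF refl])
    fix \<omega> assume "\<omega> \<in> space M"
    then show "Y' \<omega> * (real (N (Suc n) \<omega>) * real (H n k \<omega>) / real (total d H n \<omega>))
        = size_ratio n \<omega> * Y \<omega>"
      using H_ge_1[OF k, of \<omega> n] by (simp add: Y'_def size_ratio_def)
  qed
  finally show ?thesis .
qed

lemma integrable_draw_ratio_square:
  assumes "k \<in> {1..d}"
  shows "integrable M (\<lambda>\<omega>. (draw_ratio n k \<omega>)\<^sup>2)"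
  unfolding power2_eq_square
  by (rule integrable_AE_bounded_mult[where a = C1 and b = C1])
    (use AE_draw_ratio_le[OF assms] draw_ratio_measurable[OF assms] in
      \<open>simp_all add: draw_ratio_nonneg\<close>)

lemma indep_replacement_mean:
  fixes \<phi> :: "real \<Rightarrow> real" and W :: "'a \<Rightarrow> real"
  assumes "k \<in> {1..d}" "\<phi> \<in> borel_measurable borel" "W \<in> borel_measurable (draw_alg n)"
    and "integrable M (\<lambda>\<omega>. \<phi> (A (Suc n) k \<omega>))" "integrable M W"
  shows "integrable M (\<lambda>\<omega>. \<phi> (A (Suc n) k \<omega>) * W \<omega>)"
    and "(\<integral>\<omega>. \<phi> (A (Suc n) k \<omega>) * W \<omega> \<partial>M) = (\<integral>\<omega>. \<phi> (A (Suc n) k \<omega>) \<partial>M) * (\<integral>\<omega>. W \<omega> \<partial>M)"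
  using indep_var_integrable[OF indep_replacement[OF assms(1-3)] assms(4,5)]
    indep_var_lebesgue_integral[OF indep_replacement[OF assms(1-3)] assms(4,5)] .

text \<open>
  Since \<open>size_ratio n\<close> is a conditional mean of \<open>draw_ratio n k\<close>, its second moment is no larger.
\<close>

lemma size_ratio_square:
  assumes k: "k \<in> {1..d}"
  shows "integrable M (\<lambda>\<omega>. (size_ratio n \<omega>)\<^sup>2)"
    and "(\<integral>\<omega>. (size_ratio n \<omega>)\<^sup>2 \<partial>M) \<le> (\<integral>\<omega>. (draw_ratio n k \<omega>)\<^sup>2 \<partial>M)"
proof -
  note meas = size_ratio_measurable(2)[of n] draw_ratio_measurable(3)[OF k, of n]
  have b: "AE \<omega> in M. \<bar>size_ratio n \<omega>\<bar> \<le> 1" "AE \<omega> in M. \<bar>draw_ratio n k \<omega>\<bar> \<le> C1"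
    using AE_size_ratio_le[of n] AE_draw_ratio_le[OF k, of n]
    by (simp_all add: size_ratio_nonneg draw_ratio_nonneg)
  show int: "integrable M (\<lambda>\<omega>. (size_ratio n \<omega>)\<^sup>2)"
    unfolding power2_eq_square by (rule integrable_AE_bounded_mult[OF meas(1,1) b(1,1)])
  have int': "integrable M (\<lambda>\<omega>. draw_ratio n k \<omega> * size_ratio n \<omega>)"
    by (rule integrable_AE_bounded_mult[OF meas(2,1) b(2,1)])
  \<comment> \<open>\<open>size_ratio\<close> is at most \<open>1\<close> only almost surely; its truncation is bounded everywhere and
    may serve as a test function.\<close>
  define Y where "Y = (\<lambda>\<omega>. min (size_ratio n \<omega>) 1)"
  have Y: "Y \<in> borel_measurable (G n)"
    unfolding Y_def using size_ratio_measurable(1)[of n n] by simp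
  have [measurable]: "Y \<in> borel_measurable M" using measurable_from_subalg[OF subalgebra_G Y] .
  have YS: "AE \<omega> in M. Y \<omega> = size_ratio n \<omega>"
    using AE_size_ratio_le[of n] by eventually_elim (simp add: Y_def)
  have "(\<integral>\<omega>. draw_ratio n k \<omega> * size_ratio n \<omega> \<partial>M) = (\<integral>\<omega>. draw_ratio n k \<omega> * Y \<omega> \<partial>M)"
    by (rule integral_cong_AE) (use meas YS in auto)
  also have "\<dots> = (\<integral>\<omega>. size_ratio n \<omega> * Y \<omega> \<partial>M)"
    by (rule draw_ratio_mean[OF k Y, of 1]) (auto simp: Y_def size_ratio_nonneg)
  also have "\<dots> = (\<integral>\<omega>. (size_ratio n \<omega>)\<^sup>2 \<partial>M)"
    by (rule integral_cong_AE) (use meas YS in \<open>auto simp: power2_eq_square\<close>)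
  finally have cross: "(\<integral>\<omega>. draw_ratio n k \<omega> * size_ratio n \<omega> \<partial>M) = (\<integral>\<omega>. (size_ratio n \<omega>)\<^sup>2 \<partial>M)" .
  have "0 \<le> (\<integral>\<omega>. (draw_ratio n k \<omega> - size_ratio n \<omega>)\<^sup>2 \<partial>M)" by simp
  also have "\<dots> = (\<integral>\<omega>. (draw_ratio n k \<omega>)\<^sup>2 + (size_ratio n \<omega>)\<^sup>2
      - 2 * (draw_ratio n k \<omega> * size_ratio n \<omega>) \<partial>M)"
    by (simp add: power2_diff mult.assoc)
  also have "\<dots> = (\<integral>\<omega>. (draw_ratio n k \<omega>)\<^sup>2 \<partial>M) - (\<integral>\<omega>. (size_ratio n \<omega>)\<^sup>2 \<partial>M)"
    using int int' integrable_draw_ratio_square[OF k, of n] cross by simp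
  finally show "(\<integral>\<omega>. (size_ratio n \<omega>)\<^sup>2 \<partial>M) \<le> (\<integral>\<omega>. (draw_ratio n k \<omega>)\<^sup>2 \<partial>M)" by simp
qed

text \<open>
  The colour itself pays for the fluctuations: \<open>1 / H\<^sub>n\<^sub>k\<close> decreases at stage \<open>n + 1\<close> by at least a
  constant multiple of \<open>X\<^sub>n\<^sub>+\<^sub>1\<^sub>,\<^sub>k / H\<^sub>n\<^sub>k\<^sup>2\<close>, because draws are bounded by \<open>C1\<close> and replacements are
  at least \<open>1\<close>.
\<close>

lemma AE_sum_draw_ratio_square:
  assumes k: "k \<in> {1..d}"
  shows "AE \<omega> in M. \<forall>n. (\<Sum>i<n. (draw_ratio i k \<omega>)\<^sup>2) \<le> C1 * (1 + C1)"
  using AE_X_le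
proof (rule AE_mp, intro AE_I2 impI allI)
  fix \<omega> n assume \<omega>: "\<omega> \<in> space M" and le: "\<forall>n. \<forall>k\<in>{1..d}. real (X (Suc n) k \<omega>) \<le> C1"
  let ?h = "\<lambda>n. real (H n k \<omega>)"
  have h1: "1 \<le> ?h n" for n using H_ge_1[OF k \<omega>, of n] by simp
  have step: "(draw_ratio n k \<omega>)\<^sup>2 \<le> C1 * (1 + C1) * (1 / ?h n - 1 / ?h (Suc n))" for n
  proof -
    let ?x = "real (X (Suc n) k \<omega>)"
    have x: "0 \<le> ?x" "?x \<le> C1" using le k by auto
    have h: "0 < ?h n" using h1[of n] by simp
    have *: "?h n + ?x \<le> ?h n * (1 + C1)"
      using x h1[of n] mult_right_mono[of 1 "?h n" C1] by (simp add: algebra_simps)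
    have "?x * ?x / (?h n * ?h n) \<le> C1 * (1 + C1) * (?x / (?h n * (?h n + ?x)))"
    proof -
      have "?x * ?x / (?h n * ?h n) \<le> C1 * ?x / (?h n * ?h n)"
        using x h by (intro divide_right_mono mult_right_mono) auto
      also have "\<dots> = C1 * (1 + C1) * (?x / (?h n * (?h n * (1 + C1))))"
      proof -
        have "(1 + C1) * (?x / (?h n * (?h n * (1 + C1)))) = ?x / (?h n * ?h n)"
          using C1_pos by simp
        then show ?thesis by (metis mult.assoc times_divide_eq_right)
      qed
      also have "\<dots> \<le> C1 * (1 + C1) * (?x / (?h n * (?h n + ?x)))"
        using C1_pos h x * by (intro mult_left_mono divide_left_mono mult_pos_pos) auto
      finally show ?thesis .
    qed
    also have "?x / (?h n * (?h n + ?x)) = 1 / ?h n - 1 / (?h n + ?x)"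
      using h x by (simp add: field_simps)
    also have "\<dots> \<le> 1 / ?h n - 1 / ?h (Suc n)"
      using H_mono[OF k \<omega>, of n] h x by (intro diff_left_mono divide_left_mono mult_pos_pos) auto
    finally show ?thesis
      using C1_pos by (simp add: draw_ratio_def power2_eq_square mult_left_mono)
  qed
  have "(\<Sum>i<n. (draw_ratio i k \<omega>)\<^sup>2) \<le> (\<Sum>i<n. C1 * (1 + C1) * (1 / ?h i - 1 / ?h (Suc i)))"
    by (rule sum_mono) (rule step)
  also have "\<dots> = C1 * (1 + C1) * (1 / ?h 0 - 1 / ?h n)"
    by (simp only: sum_distrib_left[symmetric] sum_lessThan_telescope'[of "\<lambda>i. 1 / ?h i"])
  also have "\<dots> \<le> C1 * (1 + C1) * 1"
  proof (intro mult_left_mono)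
    have "1 / ?h 0 \<le> 1" using h1[of 0] by simp
    then show "1 / ?h 0 - 1 / ?h n \<le> 1" using h1[of n] by (smt (verit) divide_nonneg_nonneg)
  qed (use C1_pos in auto)
  finally show "(\<Sum>i<n. (draw_ratio i k \<omega>)\<^sup>2) \<le> C1 * (1 + C1)" by simp
qed

lemma sum_mean_draw_ratio_square:
  assumes k: "k \<in> {1..d}"
  shows "(\<Sum>i<n. \<integral>\<omega>. (draw_ratio i k \<omega>)\<^sup>2 \<partial>M) \<le> C1 * (1 + C1)"
proof -
  have "(\<Sum>i<n. \<integral>\<omega>. (draw_ratio i k \<omega>)\<^sup>2 \<partial>M) = (\<integral>\<omega>. (\<Sum>i<n. (draw_ratio i k \<omega>)\<^sup>2) \<partial>M)"
    by (rule Bochner_Integration.integral_sum[symmetric]) (rule integrable_draw_ratio_square[OF k])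
  also have "\<dots> \<le> (\<integral>\<omega>. C1 * (1 + C1) \<partial>M)"
    using AE_sum_draw_ratio_square[OF k] integrable_draw_ratio_square[OF k]
    by (intro integral_mono_AE) auto
  finally show ?thesis by (simp add: prob_space)
qed

lemma total_ge_1:
  assumes "1 \<le> d" "\<omega> \<in> space M"
  shows "1 \<le> total d H n \<omega>"
proof -
  have "H n 1 \<omega> \<le> total d H n \<omega>"
    unfolding total_def using assms by (intro member_le_sum) auto
  then show ?thesis using H_ge_1[of 1 \<omega> n] assms by simp
qed

lemma growth_nonneg: "k \<in> {1..d} \<Longrightarrow> \<omega> \<in> space M \<Longrightarrow> 0 \<le> growth n k \<omega>"
  using replacement_ge_1[of "Suc n" k \<omega>] by (simp add: growth_def draw_ratio_nonneg)

lemma ln_H_Suc: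
  assumes "k \<in> {1..d}" "\<omega> \<in> space M"
  shows "ln (real (H (Suc n) k \<omega>)) = ln (real (H n k \<omega>)) + ln (1 + growth n k \<omega>)"
proof -
  have "real (H (Suc n) k \<omega>) = real (H n k \<omega>) * (1 + growth n k \<omega>)"
    using H_Suc[OF assms, of n] H_ge_1[OF assms, of n]
    by (simp add: growth_def draw_ratio_def distrib_left)
  then show ?thesis
    using H_ge_1[OF assms, of n] growth_nonneg[OF assms, of n] by (simp add: ln_mult)
qed

lemma ln_H_bounds:
  assumes "k \<in> {1..d}" "\<omega> \<in> space M"
  shows "ln (real (H n k \<omega>)) \<le> ln (real (H 0 k \<omega>)) + (\<Sum>i<n. growth i k \<omega>)"
    and "ln (real (H 0 k \<omega>)) + (\<Sum>i<n. growth i k \<omega>) - (\<Sum>i<n. (growth i k \<omega>)\<^sup>2)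
      \<le> ln (real (H n k \<omega>))"
proof (induction n)
  case (Suc n)
  {
    case 1
    then show ?case
      using Suc(1) ln_H_Suc[OF assms, of n] ln_add_one_self_le_self[OF growth_nonneg[OF assms, of n]]
      by simp
  next
    case 2
    then show ?case
      using Suc(2) ln_H_Suc[OF assms, of n] ln_one_plus_lower_bound[OF growth_nonneg[OF assms, of n]]
      by simp
  }
qed simp_all

end

section \<open>Bounded second moments of the replacements\<close>

text \<open>An urn whose replacements have second moments bounded by a constant.\<close>

locale moment_bounded_urn = multidraw_urn +
  fixes C2 :: real
  assumes square_integrable_A: "\<And>n k. k \<in> {1..d} \<Longrightarrow> integrable M (\<lambda>\<omega>. (A (Suc n) k \<omega>)\<^sup>2)"
    and second_moment_A: "\<And>n k. k \<in> {1..d} \<Longrightarrow> (\<integral>\<omega>. (A (Suc n) k \<omega>)\<^sup>2 \<partial>M) \<le> C2"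
begin

lemma integrable_A: "k \<in> {1..d} \<Longrightarrow> integrable M (A (Suc n) k)"
  by (rule square_integrable_imp_integrable[OF _ square_integrable_A]) (simp_all add: A_measurable)

lemma innovation_orthogonal:
  fixes Y :: "'a \<Rightarrow> real"
  assumes k: "k \<in> {1..d}"
    and Y: "Y \<in> borel_measurable (G n)" and bdd: "\<And>\<omega>. \<omega> \<in> space M \<Longrightarrow> \<bar>Y \<omega>\<bar> \<le> c"
  shows "(\<integral>\<omega>. innovation n k \<omega> * Y \<omega> \<partial>M) = 0"
proof -
  have YM: "Y \<in> borel_measurable M" using measurable_from_subalg[OF subalgebra_G Y] .
  have Yc: "AE \<omega> in M. \<bar>Y \<omega>\<bar> \<le> c" using bdd by (intro AE_I2) auto
  define W where "W = (\<lambda>\<omega>. draw_ratio n k \<omega> * Y \<omega>)"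
  have W: "W \<in> borel_measurable (draw_alg n)"
    unfolding W_def using draw_ratio_measurable(1)[OF k] G_draw_alg[OF Y]
    by (rule borel_measurable_times)
  have Wint: "integrable M W" unfolding W_def
    by (rule integrable_AE_bounded_mult[OF _ YM _ Yc, where a = C1])
      (use AE_draw_ratio_le[OF k] draw_ratio_measurable[OF k] in \<open>simp_all add: draw_ratio_nonneg\<close>)
  have Sint: "integrable M (\<lambda>\<omega>. size_ratio n \<omega> * Y \<omega>)"
    by (rule integrable_AE_bounded_mult[OF _ YM _ Yc, where a = 1])
      (use AE_size_ratio_le size_ratio_measurable in \<open>simp_all add: size_ratio_nonneg\<close>)
  note AW = indep_replacement_mean[where \<phi> = "\<lambda>x. x", OF k _ W integrable_A[OF k] Wint]
  have "(\<integral>\<omega>. innovation n k \<omega> * Y \<omega> \<partial>M)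
      = (\<integral>\<omega>. A (Suc n) k \<omega> * W \<omega> - expectation (A (Suc n) k) * (size_ratio n \<omega> * Y \<omega>) \<partial>M)"
    by (simp add: innovation_def growth_def W_def algebra_simps)
  also have "\<dots> = expectation (A (Suc n) k) * (\<integral>\<omega>. W \<omega> \<partial>M)
      - expectation (A (Suc n) k) * (\<integral>\<omega>. size_ratio n \<omega> * Y \<omega> \<partial>M)"
    using AW Sint by simp
  also have "\<dots> = 0"
    unfolding W_def by (simp add: draw_ratio_mean[OF k Y bdd])
  finally show ?thesis .
qed

lemma growth_square:
  assumes "k \<in> {1..d}"
  shows "integrable M (\<lambda>\<omega>. (growth n k \<omega>)\<^sup>2)"
    and "(\<integral>\<omega>. (growth n k \<omega>)\<^sup>2 \<partial>M) \<le> C2 * (\<integral>\<omega>. (draw_ratio n k \<omega>)\<^sup>2 \<partial>M)"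
proof -
  have "(\<lambda>\<omega>. (draw_ratio n k \<omega>)\<^sup>2) \<in> borel_measurable (draw_alg n)"
    using draw_ratio_measurable(1)[OF assms] by (rule borel_measurable_power)
  note AW = indep_replacement_mean[OF assms _ this square_integrable_A[OF assms]
      integrable_draw_ratio_square[OF assms]]
  show "integrable M (\<lambda>\<omega>. (growth n k \<omega>)\<^sup>2)"
    unfolding growth_def power_mult_distrib by (rule AW(1)) measurable
  have "(\<integral>\<omega>. (growth n k \<omega>)\<^sup>2 \<partial>M)
      = (\<integral>\<omega>. (A (Suc n) k \<omega>)\<^sup>2 \<partial>M) * (\<integral>\<omega>. (draw_ratio n k \<omega>)\<^sup>2 \<partial>M)"
    unfolding growth_def power_mult_distrib by (rule AW(2)) measurable
  also have "\<dots> \<le> C2 * (\<integral>\<omega>. (draw_ratio n k \<omega>)\<^sup>2 \<partial>M)"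
    by (intro mult_right_mono second_moment_A assms) simp
  finally show "(\<integral>\<omega>. (growth n k \<omega>)\<^sup>2 \<partial>M) \<le> C2 * (\<integral>\<omega>. (draw_ratio n k \<omega>)\<^sup>2 \<partial>M)" .
qed

lemma mean_A_square:
  assumes "k \<in> {1..d}"
  shows "(expectation (A (Suc n) k))\<^sup>2 \<le> C2"
proof -
  have "0 \<le> variance (A (Suc n) k)" by (rule variance_positive)
  also have "\<dots> = (\<integral>\<omega>. (A (Suc n) k \<omega>)\<^sup>2 \<partial>M) - (expectation (A (Suc n) k))\<^sup>2"
    by (rule variance_eq[OF integrable_A[OF assms] square_integrable_A[OF assms]])
  finally show ?thesis using second_moment_A[OF assms, of n] by simp
qed

lemma innovation_square:
  assumes k: "k \<in> {1..d}"
  shows "integrable M (\<lambda>\<omega>. (innovation n k \<omega>)\<^sup>2)"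
    and "(\<integral>\<omega>. (innovation n k \<omega>)\<^sup>2 \<partial>M) \<le> 4 * C2 * (\<integral>\<omega>. (draw_ratio n k \<omega>)\<^sup>2 \<partial>M)"
proof -
  let ?m = "expectation (A (Suc n) k)"
  have meas: "innovation n k \<in> borel_measurable M"
    using measurable_from_subalg[OF subalgebra_G innovation_adapted[OF k lessI]] .
  have le: "(innovation n k \<omega>)\<^sup>2 \<le> 2 * (growth n k \<omega>)\<^sup>2 + 2 * (?m\<^sup>2 * (size_ratio n \<omega>)\<^sup>2)" for \<omega>
    unfolding innovation_def power_mult_distrib[symmetric]
    using sum_squares_bound[of "growth n k \<omega>" "- (?m * size_ratio n \<omega>)"]
    by (simp add: power2_diff)
  have int: "integrable M (\<lambda>\<omega>. 2 * (growth n k \<omega>)\<^sup>2 + 2 * (?m\<^sup>2 * (size_ratio n \<omega>)\<^sup>2))"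
    using growth_square(1)[OF k] size_ratio_square(1)[OF k] by simp
  show 1: "integrable M (\<lambda>\<omega>. (innovation n k \<omega>)\<^sup>2)"
    by (rule Bochner_Integration.integrable_bound[OF int]) (use meas le in \<open>auto intro!: AE_I2 order_trans[OF le]\<close>)
  have "(\<integral>\<omega>. (innovation n k \<omega>)\<^sup>2 \<partial>M)
      \<le> (\<integral>\<omega>. 2 * (growth n k \<omega>)\<^sup>2 + 2 * (?m\<^sup>2 * (size_ratio n \<omega>)\<^sup>2) \<partial>M)"
    by (rule integral_mono[OF 1 int le])
  also have "\<dots> = 2 * (\<integral>\<omega>. (growth n k \<omega>)\<^sup>2 \<partial>M) + 2 * (?m\<^sup>2 * (\<integral>\<omega>. (size_ratio n \<omega>)\<^sup>2 \<partial>M))"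
    using growth_square(1)[OF k] size_ratio_square(1)[OF k] by simp
  also have "?m\<^sup>2 * (\<integral>\<omega>. (size_ratio n \<omega>)\<^sup>2 \<partial>M) \<le> C2 * (\<integral>\<omega>. (draw_ratio n k \<omega>)\<^sup>2 \<partial>M)"
    using mean_A_square[OF k, of n] order_trans[OF zero_le_power2 mean_A_square[OF k, of n]]
    by (intro mult_mono size_ratio_square(2)[OF k]) auto
  finally show "(\<integral>\<omega>. (innovation n k \<omega>)\<^sup>2 \<partial>M) \<le> 4 * C2 * (\<integral>\<omega>. (draw_ratio n k \<omega>)\<^sup>2 \<partial>M)"
    using growth_square(2)[OF k, of n] by simp
qed

lemma C2_nonneg: "k \<in> {1..d} \<Longrightarrow> 0 \<le> C2"
  by (rule order_trans[OF zero_le_power2 mean_A_square])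

lemma AE_bounded_innovations:
  assumes k: "k \<in> {1..d}"
  shows "AE \<omega> in M. \<exists>B. \<forall>n. \<bar>\<Sum>i<n. innovation i k \<omega>\<bar> \<le> B"
proof (rule AE_bounded_partial_sums[OF subalgebra_G])
  show "(\<Sum>i<n. \<integral>\<omega>. (innovation i k \<omega>)\<^sup>2 \<partial>M) \<le> 4 * C2 * (C1 * (1 + C1))" for n
  proof -
    have "(\<Sum>i<n. \<integral>\<omega>. (innovation i k \<omega>)\<^sup>2 \<partial>M)
        \<le> (\<Sum>i<n. 4 * C2 * (\<integral>\<omega>. (draw_ratio i k \<omega>)\<^sup>2 \<partial>M))"
      by (intro sum_mono innovation_square(2) k)
    also have "\<dots> \<le> 4 * C2 * (C1 * (1 + C1))"
      unfolding sum_distrib_left[symmetric]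
      using C2_nonneg[OF k] by (intro mult_left_mono sum_mean_draw_ratio_square k) auto
    finally show ?thesis .
  qed
  show "(\<integral>\<omega>. innovation n k \<omega> * Y \<omega> \<partial>M) = 0"
    if "Y \<in> borel_measurable (G n)" "\<And>\<omega>. \<omega> \<in> space M \<Longrightarrow> \<bar>Y \<omega>\<bar> \<le> c" for n Y c
    by (rule innovation_orthogonal[OF k that])
qed (simp_all add: innovation_adapted[OF k] innovation_square(1)[OF k])

lemma AE_bounded_growth_squares:
  assumes k: "k \<in> {1..d}"
  shows "AE \<omega> in M. \<exists>B. \<forall>n. (\<Sum>i<n. (growth i k \<omega>)\<^sup>2) \<le> B"
proof (rule AE_bounded_sums_nonneg)
  show "(\<Sum>i<n. \<integral>\<omega>. (growth i k \<omega>)\<^sup>2 \<partial>M) \<le> C2 * (C1 * (1 + C1))" for n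
  proof -
    have "(\<Sum>i<n. \<integral>\<omega>. (growth i k \<omega>)\<^sup>2 \<partial>M) \<le> (\<Sum>i<n. C2 * (\<integral>\<omega>. (draw_ratio i k \<omega>)\<^sup>2 \<partial>M))"
      by (intro sum_mono growth_square(2) k)
    also have "\<dots> \<le> C2 * (C1 * (1 + C1))"
      unfolding sum_distrib_left[symmetric]
      using C2_nonneg[OF k] by (intro mult_left_mono sum_mean_draw_ratio_square k) auto
    finally show ?thesis .
  qed
qed (use growth_square(1)[OF k] in auto)

section \<open>Comparison of two colours\<close>

text \<open>
  The size of the urn is at most its initial size plus \<open>C1\<close> times the sum of all replacements, a
  bound \<open>T n\<close> whose mean grows at most linearly in \<open>n\<close>.
\<close>

lemma AE_not_summable_inverse_total:
  assumes "1 \<le> d"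
  shows "AE \<omega> in M. \<not> summable (\<lambda>n. 1 / real (total d H n \<omega>))"
proof -
  define s0 where "s0 = (\<Sum>k=1..d. real (H0 k))"
  define T where "T = (\<lambda>n \<omega>. s0 + C1 * (\<Sum>k=1..d. \<Sum>i<n. A (Suc i) k \<omega>))"
  have s0: "0 < s0"
    unfolding s0_def using initial_pos assms by (intro sum_pos) auto
  have A_nonneg: "0 \<le> A (Suc i) k \<omega>" if "k \<in> {1..d}" "\<omega> \<in> space M" for i k \<omega>
    using replacement_ge_1[of "Suc i" k \<omega>] that by simp
  have meanA: "expectation (A (Suc i) k) \<le> C2" if k: "k \<in> {1..d}" for i k
  proof -
    have "expectation (A (Suc i) k) \<le> (\<integral>\<omega>. (A (Suc i) k \<omega>)\<^sup>2 \<partial>M)"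
    proof (rule integral_mono[OF integrable_A[OF k] square_integrable_A[OF k]])
      fix \<omega> assume "\<omega> \<in> space M"
      then show "A (Suc i) k \<omega> \<le> (A (Suc i) k \<omega>)\<^sup>2"
        using replacement_ge_1[of "Suc i" k \<omega>] k by (intro self_le_power) auto
    qed
    also have "\<dots> \<le> C2" by (rule second_moment_A[OF k])
    finally show ?thesis .
  qed
  have T_mono: "T n \<omega> \<le> T (Suc n) \<omega>" if "\<omega> \<in> space M" for n \<omega>
    unfolding T_def using C1_pos A_nonneg that
    by (intro add_left_mono mult_left_mono sum_mono) auto
  have T_pos: "0 < T n \<omega>" if "\<omega> \<in> space M" for n \<omega>
    unfolding T_def using s0 C1_pos A_nonneg that
    by (intro add_pos_nonneg mult_nonneg_nonneg sum_nonneg) auto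
  have int_sum: "integrable M (\<lambda>\<omega>. \<Sum>i<n. A (Suc i) k \<omega>)" if "k \<in> {1..d}" for n k
    by (intro Bochner_Integration.integrable_sum integrable_A that)
  have int_sums: "integrable M (\<lambda>\<omega>. \<Sum>k=1..d. \<Sum>i<n. A (Suc i) k \<omega>)" for n
    by (intro Bochner_Integration.integrable_sum int_sum)
  have "AE \<omega> in M. \<not> summable (\<lambda>n. 1 / T n \<omega>)"
  proof (rule AE_not_summable_inverse[where T = T, OF _ T_pos T_mono])
    show "integrable M (T n)" for n
      unfolding T_def using int_sums by simp
    show "(\<integral>\<omega>. T n \<omega> \<partial>M) \<le> (s0 + C1 * (real d * C2)) * real (Suc n)" for n
    proof -
      have C2: "0 \<le> C2" using C2_nonneg[of 1] assms by simp
      have "(\<integral>\<omega>. (\<Sum>k=1..d. \<Sum>i<n. A (Suc i) k \<omega>) \<partial>M)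
          = (\<Sum>k=1..d. \<integral>\<omega>. (\<Sum>i<n. A (Suc i) k \<omega>) \<partial>M)"
        by (rule Bochner_Integration.integral_sum) (rule int_sum)
      also have "\<dots> = (\<Sum>k=1..d. \<Sum>i<n. expectation (A (Suc i) k))"
        by (intro sum.cong refl Bochner_Integration.integral_sum integrable_A)
      finally have "(\<integral>\<omega>. T n \<omega> \<partial>M) = s0 + C1 * (\<Sum>k=1..d. \<Sum>i<n. expectation (A (Suc i) k))"
        unfolding T_def using int_sums by (simp add: prob_space)
      also have "\<dots> \<le> s0 + C1 * (\<Sum>k=1..d. \<Sum>i<n. C2)"
        using C1_pos meanA by (intro add_left_mono mult_left_mono sum_mono) auto
      also have "\<dots> = s0 * 1 + C1 * (real d * C2) * real n" by simp
      also have "\<dots> \<le> s0 * real (Suc n) + C1 * (real d * C2) * real (Suc n)"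
        using s0 C1_pos C2 by (intro add_mono mult_left_mono) auto
      finally show ?thesis by (simp only: distrib_right)
    qed
  qed auto
  then show ?thesis using AE_X_le
  proof (rule AE_mp[OF AE_conjI], intro AE_I2 impI, elim conjE)
    fix \<omega> assume \<omega>: "\<omega> \<in> space M" and X: "\<forall>n. \<forall>k\<in>{1..d}. real (X (Suc n) k \<omega>) \<le> C1"
      and ns: "\<not> summable (\<lambda>n. 1 / T n \<omega>)"
    have "real (total d H n \<omega>) \<le> T n \<omega>" for n
    proof -
      have "real (total d H n \<omega>)
          = (\<Sum>k=1..d. real (H0 k) + (\<Sum>i<n. A (Suc i) k \<omega> * real (X (Suc i) k \<omega>)))"
        unfolding total_def of_nat_sum using composition \<omega>
        by (intro sum.cong) (auto simp: sum.atLeast1_atMost_eq)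
      also have "\<dots> \<le> (\<Sum>k=1..d. real (H0 k) + (\<Sum>i<n. A (Suc i) k \<omega> * C1))"
        using X A_nonneg \<omega> by (intro sum_mono add_left_mono mult_left_mono) auto
      also have "\<dots> = T n \<omega>"
        by (simp add: T_def s0_def sum.distrib sum_distrib_left mult.commute)
      finally show ?thesis .
    qed
    then have "1 / T n \<omega> \<le> 1 / real (total d H n \<omega>)" for n
      using total_ge_1[OF assms \<omega>, of n] T_pos[OF \<omega>, of n]
      by (intro divide_left_mono) (auto intro!: mult_pos_pos)
    then show "\<not> summable (\<lambda>n. 1 / real (total d H n \<omega>))"
      using ns summable_comparison_test'[of "\<lambda>n. 1 / real (total d H n \<omega>)" 0 "\<lambda>n. 1 / T n \<omega>"] T_pos[OF \<omega>]
      by (auto simp: less_imp_le)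
  qed
qed

text \<open>
  A colour whose limiting mean replacement is smaller than that of some other colour is negligible:
  the logarithm of the ratio of the two counts tends to \<open>-\<infinity>\<close>.
\<close>

theorem AE_dominated_proportion:
  assumes jk: "j \<in> {1..d}" "k \<in> {1..d}"
    and lim: "(\<lambda>n. expectation (A n j)) \<longlonglongrightarrow> mj" "(\<lambda>n. expectation (A n k)) \<longlonglongrightarrow> mk" "mj < mk"
  shows "AE \<omega> in M. (\<lambda>n. proportion d H n j \<omega>) \<longlonglongrightarrow> 0"
proof -
  have d: "1 \<le> d" using jk by auto
  let ?c = "\<lambda>n. expectation (A (Suc n) k) - expectation (A (Suc n) j)"
  have c: "?c \<longlonglongrightarrow> mk - mj"
    by (intro tendsto_diff LIMSEQ_Suc lim)
  note facts = AE_bounded_innovations[OF jk(1)] AE_bounded_innovations[OF jk(2)]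
    AE_bounded_growth_squares[OF jk(2)] AE_not_summable_inverse_total[OF d] AE_sample_size AE_space
  show ?thesis using facts
  proof eventually_elim
    case (elim \<omega>)
    then obtain Bj Bk B where B: "\<And>n. \<bar>\<Sum>i<n. innovation i j \<omega>\<bar> \<le> Bj"
      "\<And>n. \<bar>\<Sum>i<n. innovation i k \<omega>\<bar> \<le> Bk" "\<And>n. (\<Sum>i<n. (growth i k \<omega>)\<^sup>2) \<le> B" by metis
    have \<omega>: "\<omega> \<in> space M" by fact
    let ?S = "\<lambda>n. \<Sum>i<n. ?c i * size_ratio i \<omega>"
    have S: "filterlim ?S at_top sequentially"
    proof (rule filterlim_weighted_sums_at_top[OF _ elim(4) _ c])
      show "1 / real (total d H n \<omega>) \<le> size_ratio n \<omega>" for n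
        using elim(5) by (simp add: size_ratio_def divide_right_mono)
    qed (use lim in auto)
    \<comment> \<open>The bounds on the innovations and on the quadratic error of the logarithm, together with the
      initial value.\<close>
    let ?K = "ln (real (H 0 j \<omega>)) - ln (real (H 0 k \<omega>)) + Bj + Bk + B"
    have ln_le: "ln (real (H n j \<omega>)) - ln (real (H n k \<omega>)) \<le> ?K - ?S n" for n
    proof -
      have "(\<Sum>i<n. growth i j \<omega>) - (\<Sum>i<n. growth i k \<omega>)
          = (\<Sum>i<n. innovation i j \<omega>) - (\<Sum>i<n. innovation i k \<omega>) - ?S n"
        by (simp add: innovation_def sum_subtractf[symmetric] algebra_simps)
      then show ?thesis
        using ln_H_bounds(1)[OF jk(1) \<omega>, of n] ln_H_bounds(2)[OF jk(2) \<omega>, of n] B(1)[of n] B(2)[of n] B(3)[of n]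
        by linarith
    qed
    have prop_le: "proportion d H n j \<omega> \<le> exp (?K - ?S n)" for n
    proof -
      have pos: "0 < real (H n j \<omega>)" "0 < real (H n k \<omega>)"
        using H_ge_1[OF jk(1) \<omega>, of n] H_ge_1[OF jk(2) \<omega>, of n] by auto
      have "H n k \<omega> \<le> total d H n \<omega>"
        unfolding total_def using jk(2) by (intro member_le_sum) auto
      then have "proportion d H n j \<omega> \<le> real (H n j \<omega>) / real (H n k \<omega>)"
        unfolding proportion_def using pos by (intro divide_left_mono) auto
      also have "\<dots> = exp (ln (real (H n j \<omega>)) - ln (real (H n k \<omega>)))"
        using pos by (simp add: exp_diff)
      also have "\<dots> \<le> exp (?K - ?S n)" using ln_le by simp
      finally show ?thesis .
    qed
    have "filterlim (\<lambda>n. - ?S n) at_bot sequentially"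
      using S by (simp add: filterlim_uminus_at_bot)
    then have "(\<lambda>n. exp ?K * exp (- ?S n)) \<longlonglongrightarrow> exp ?K * 0"
      by (intro tendsto_mult tendsto_const filterlim_compose[OF exp_at_bot])
    then have "(\<lambda>n. exp (?K - ?S n)) \<longlonglongrightarrow> 0"
      by (simp only: mult_exp_exp mult_zero_right diff_conv_add_uminus)
    then show "(\<lambda>n. proportion d H n j \<omega>) \<longlonglongrightarrow> 0"
      by (rule tendsto_sandwich[OF _ _ tendsto_const, rotated 2])
        (use prop_le in \<open>auto simp: proportion_def\<close>)
  qed
qed

end

section \<open>Dominant colours take over\<close>

text \<open>Since \<open>A \<ge> 1\<close>, the second moment is at most the third.\<close>

lemma moment_bounded_urnI:
  assumes urn: "multidraw_urn M d C1 H0 N X A H"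
    and bound: "\<And>k. k \<in> {1..d} \<Longrightarrow> (SUP n\<in>{1..}. \<integral>\<^sup>+\<omega>. ennreal (A n k \<omega> ^ 3) \<partial>M) < ennreal C2"
  shows "moment_bounded_urn M d C1 H0 N X A H C2"
proof -
  interpret multidraw_urn M d C1 H0 N X A H by (rule urn)
  show ?thesis
  proof
    fix n k assume k: "k \<in> {1..d}"
    have A1: "1 \<le> A (Suc n) k \<omega>" if "\<omega> \<in> space M" for \<omega>
      using replacement_ge_1[of "Suc n" k \<omega>] k that by simp
    have [measurable]: "A (Suc n) k \<in> borel_measurable M" using A_measurable k by simp
    have "(\<integral>\<^sup>+\<omega>. ennreal ((A (Suc n) k \<omega>)\<^sup>2) \<partial>M) \<le> (\<integral>\<^sup>+\<omega>. ennreal (A (Suc n) k \<omega> ^ 3) \<partial>M)"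
      using A1 by (intro nn_integral_mono ennreal_leI power_increasing) auto
    also have "\<dots> \<le> (SUP n\<in>{1..}. \<integral>\<^sup>+\<omega>. ennreal (A n k \<omega> ^ 3) \<partial>M)"
      by (rule SUP_upper) simp
    also have "\<dots> < ennreal C2" by (rule bound[OF k])
    finally have *: "(\<integral>\<^sup>+\<omega>. ennreal ((A (Suc n) k \<omega>)\<^sup>2) \<partial>M) < ennreal C2" .
    then show int: "integrable M (\<lambda>\<omega>. (A (Suc n) k \<omega>)\<^sup>2)"
      by (intro integrableI_nonneg) (auto intro: order.strict_trans)
    have "ennreal (\<integral>\<omega>. (A (Suc n) k \<omega>)\<^sup>2 \<partial>M) < ennreal C2"
      using * nn_integral_eq_integral[OF int] by simp
    then show "(\<integral>\<omega>. (A (Suc n) k \<omega>)\<^sup>2 \<partial>M) \<le> C2"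
      by (simp add: ennreal_less_iff)
  qed
qed

theorem theorem3p3:
  fixes M :: "'a measure"
    and d t :: nat
    and C1 C2 :: real
    and H0 :: "nat \<Rightarrow> nat"
    and N :: "nat \<Rightarrow> 'a \<Rightarrow> nat"
    and X :: "nat \<Rightarrow> nat \<Rightarrow> 'a \<Rightarrow> nat"
    and A :: "nat \<Rightarrow> nat \<Rightarrow> 'a \<Rightarrow> real"
    and H :: "nat \<Rightarrow> nat \<Rightarrow> 'a \<Rightarrow> nat"
    and m :: "nat \<Rightarrow> real"
  assumes urn: "multidraw_urn M d C1 H0 N X A H"
    and A1: "\<And>k. k \<in> {1..d} \<Longrightarrow>
          (SUP n\<in>{1..}. \<integral>\<^sup>+\<omega>. ennreal (A n k \<omega> ^ 3) \<partial>M) < ennreal C2"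
    and A2_lim: "\<And>k. k \<in> {1..d} \<Longrightarrow>
          (\<lambda>n. prob_space.expectation M (A n k)) \<longlonglongrightarrow> m k"
    and A2_t: "t \<in> {1..d}"
    and A2_top: "\<And>k. k \<in> {1..t} \<Longrightarrow> m k = m 1"
    and A2_gap: "t < d \<Longrightarrow> m t > m (t + 1)"
    and A2_dec: "\<And>k. t + 1 \<le> k \<Longrightarrow> k < d \<Longrightarrow> m k \<ge> m (k + 1)"
    and A2_means: "\<And>n k. n \<ge> 1 \<Longrightarrow> k \<in> {1..t} \<Longrightarrow>
          prob_space.expectation M (A n k) = prob_space.expectation M (A n 1)"
  shows "(AE \<omega> in M. (\<lambda>n. \<Sum>k=1..t. proportion d H n k \<omega>) \<longlonglongrightarrow> 1) \<and>
         (\<forall>k\<in>{t+1..d}. \<exists>Z \<in> borel_measurable M.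
            (AE \<omega> in M. (\<lambda>n. proportion d H n k \<omega>) \<longlonglongrightarrow> Z \<omega>) \<and>
            measure M {\<omega> \<in> space M. Z \<omega> = 0} = 1)"
proof -
  interpret moment_bounded_urn M d C1 H0 N X A H C2
    by (rule moment_bounded_urnI[OF urn A1])
  have m_le: "m k \<le> m (t + 1)" if "t + 1 \<le> k" "k \<le> d" for k
    using that
  proof (induction k rule: dec_induct)
    case (step k)
    then show ?case using A2_dec[of k] by simp
  qed simp
  have null: "AE \<omega> in M. (\<lambda>n. proportion d H n k \<omega>) \<longlonglongrightarrow> 0" if k: "k \<in> {t+1..d}" for k
  proof (rule AE_dominated_proportion[OF _ _ A2_lim A2_lim])
    show "m k < m 1"
      using A2_gap A2_top[of t] A2_t m_le[of k] k by auto
  qed (use k A2_t in auto)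
  have "AE \<omega> in M. \<forall>k\<in>{t+1..d}. (\<lambda>n. proportion d H n k \<omega>) \<longlonglongrightarrow> 0"
    using null by (intro AE_ball_countable') auto
  then have "AE \<omega> in M. (\<lambda>n. \<Sum>k=1..t. proportion d H n k \<omega>) \<longlonglongrightarrow> 1"
  proof (rule AE_mp, intro AE_I2 impI)
    fix \<omega> assume \<omega>: "\<omega> \<in> space M" and lim: "\<forall>k\<in>{t+1..d}. (\<lambda>n. proportion d H n k \<omega>) \<longlonglongrightarrow> 0"
    have split: "1 - (\<Sum>k=t+1..d. proportion d H n k \<omega>) = (\<Sum>k=1..t. proportion d H n k \<omega>)" for n
    proof -
      have "(\<Sum>k=1..d. proportion d H n k \<omega>) = 1"
        using total_ge_1[OF _ \<omega>, of n] A2_t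
        unfolding proportion_def sum_divide_distrib[symmetric] of_nat_sum[symmetric]
          total_def[symmetric] by simp
      moreover have "{1..d} = {1..t} \<union> {t+1..d}" using A2_t by auto
      ultimately show ?thesis by (simp add: sum.union_disjoint)
    qed
    have "(\<lambda>n. 1 - (\<Sum>k=t+1..d. proportion d H n k \<omega>)) \<longlonglongrightarrow> 1 - (\<Sum>k=t+1..d. 0)"
      using lim by (intro tendsto_diff tendsto_const tendsto_sum) auto
    then show "(\<lambda>n. \<Sum>k=1..t. proportion d H n k \<omega>) \<longlonglongrightarrow> 1"
      unfolding split by simp
  qed
  moreover have "\<exists>Z \<in> borel_measurable M. (AE \<omega> in M. (\<lambda>n. proportion d H n k \<omega>) \<longlonglongrightarrow> Z \<omega>) \<and>
      measure M {\<omega> \<in> space M. Z \<omega> = 0} = 1" if "k \<in> {t+1..d}" for k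
    using null[OF that] by (intro bexI[of _ "\<lambda>_. 0"]) (auto simp: prob_space)
  ultimately show ?thesis by blast
qed

end
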